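(* Let $S$ be a Coble surface over an algebraically closed field of characteristic $2$ with boundary components $B_1,\dots,B_n$, let $A$ be its conductrix, let $\eta$ be the canonical rational $1$-form on $S$, and let $B$ be the bi-conductrix, i.e. the effective divisor with $(\eta)=-\sum_{i=1}^nB_i+B$. Then $(\eta)=-\sum_{i=1}^nB_i+2A$, i.e. $B=2A$.
   Context: A Coble surface $S$ is a non-singular projective rational surface over $k$ with $|-K_S|=\emptyset$ and $|-2K_S|=\{B_1+\cdots+B_n\}$, where the $B_i$ are non-singular rational curves with $B_i\cap B_j=\emptyset$ for $i\ne j$ (the boundary components). Canonical covering: take a sufficiently fine affine open covering $\{U_i=\mathrm{Spec}\,A_i\}$ of $S$, let $f_i\in A_i$ be a local equation of $B_1+\cdots+B_n$ on $U_i$, and let $\{f_{ij}\}$ be a cocycle giving $\mathcal O_S(-K_S)$. There are units $g_i\in\Gamma(U_i,\mathcal O_S^* )$ with $f_{ij}^2=(f_i/f_j)(g_i/g_j)$. The canonical covering $\pi:X\to S$ is the finite flat covering obtained by gluing $\mathrm{Spec}\,A_i[z_i]/(z_i^2-f_ig_i)$ via $z_i=f_{ij}z_j$. The $1$-form: $\eta=d(f_ig_i)/(f_ig_i)$ on $U_i$; these agree on overlaps and define a rational $1$-form $\eta$ on $S$, with divisor (divisorial part of zeros and poles) $(\eta)$. It has poles of order exactly $1$ along the $B_i$ and no other poles, so $(\eta)=-\sum_iB_i+B$ with $B$ effective; $B$ is called the bi-conductrix. Conductrix: let $\nu:X'\to X$ be the normalization. After refining the covering, the ring of $X'$ over $U_i$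 is $A_i\oplus A_iw_i$ with $w_i^2=h_i\in A_i$, and the map $A_i\oplus A_iz_i\to A_i\oplus A_iw_i$ sends $z_i\mapsto b_i+a_iw_i$ with $a_i,b_i\in A_i$. The Cartier divisors $(a_i)$ glue to an effective divisor $A$ on $S$, the conductrix of $S$. *)

theory Defs
  imports "HOL-Computational_Algebra.Computational_Algebra" "HOL-Library.Poly_Mapping"
begin

text \<open>
  Integral separated schemes of finite type over a field are encoded in the classical way, as
  Chevalley schemes (EGA I, 8): the function field is the type \<open>'a\<close>, an algebra over the base field
  \<open>'k\<close> via an embedding \<open>\<iota>\<close>, and the scheme is the set \<open>S\<close> of the local rings of its points, all of
  them subrings of the function field. Distinct points have distinct local rings, and a point \<open>P\<close>
  is a generization of a point \<open>Q\<close> iff \<open>Q \<subseteq> P\<close>. The generic point is \<open>UNIV\<close>.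
\<close>

section \<open>Subrings of a field and their localizations\<close>

definition field_embedding :: "('k::field \<Rightarrow> 'a::field) \<Rightarrow> bool" where
  "field_embedding \<iota> \<longleftrightarrow> \<iota> 1 = 1 \<and> (\<forall>x y. \<iota> (x + y) = \<iota> x + \<iota> y \<and> \<iota> (x * y) = \<iota> x * \<iota> y)"

inductive_set alg_gen :: "('k::field \<Rightarrow> 'a::field) \<Rightarrow> 'a set \<Rightarrow> 'a set"
  for \<iota> :: "'k::field \<Rightarrow> 'a::field" and X :: "'a set" where
  scalar: "\<iota> c \<in> alg_gen \<iota> X"
| gen: "x \<in> X \<Longrightarrow> x \<in> alg_gen \<iota> X"
| add: "x \<in> alg_gen \<iota> X \<Longrightarrow> y \<in> alg_gen \<iota> X \<Longrightarrow> x + y \<in> alg_gen \<iota> X"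
| mult: "x \<in> alg_gen \<iota> X \<Longrightarrow> y \<in> alg_gen \<iota> X \<Longrightarrow> x * y \<in> alg_gen \<iota> X"

text \<open>The span of \<open>G\<close> with coefficients in \<open>R\<close>.\<close>

inductive_set lspan :: "('a::comm_ring_1 \<Rightarrow> 'm::ab_group_add \<Rightarrow> 'm) \<Rightarrow> 'a set \<Rightarrow> 'm set \<Rightarrow> 'm set"
  for scale :: "'a::comm_ring_1 \<Rightarrow> 'm::ab_group_add \<Rightarrow> 'm" and R :: "'a set" and G :: "'m set" where
  zero: "0 \<in> lspan scale R G"
| step: "a \<in> R \<Longrightarrow> g \<in> G \<Longrightarrow> u \<in> lspan scale R G \<Longrightarrow> u + scale a g \<in> lspan scale R G"

definition prime_ideal :: "'a::field set \<Rightarrow> 'a set \<Rightarrow> bool" where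
  "prime_ideal R p \<longleftrightarrow> p \<subseteq> R \<and> 0 \<in> p \<and> 1 \<notin> p \<and> (\<forall>x\<in>p. \<forall>y\<in>p. x + y \<in> p) \<and>
     (\<forall>x\<in>R. \<forall>y\<in>p. x * y \<in> p) \<and> (\<forall>x\<in>R. \<forall>y\<in>R. x * y \<in> p \<longrightarrow> x \<in> p \<or> y \<in> p)"

definition localization :: "'a::field set \<Rightarrow> 'a set \<Rightarrow> 'a set" where
  "localization R p = {x / y | x y. x \<in> R \<and> y \<in> R - p}"

definition spec :: "'a::field set \<Rightarrow> 'a set set" where
  "spec R = {localization R p | p. prime_ideal R p}"

text \<open>The set of non-units; it is the maximal ideal when \<open>R\<close> is local.\<close>

definition max_ideal :: "'a::field set \<Rightarrow> 'a set" where
  "max_ideal R = {x \<in> R. x = 0 \<or> inverse x \<notin> R}"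

text \<open>
  The next two notions concern the quotient ring \<open>R/p\<close> (and \<open>R\<close> itself for \<open>p = {0}\<close>). Since \<open>R/p\<close> is
  not a subring of \<open>'a\<close>, its ideals are written as ideals of \<open>R\<close> containing \<open>p\<close>.
\<close>

definition prime_chain :: "'a::field set \<Rightarrow> 'a set \<Rightarrow> nat \<Rightarrow> (nat \<Rightarrow> 'a set) \<Rightarrow> bool" where
  "prime_chain R p d c \<longleftrightarrow> (\<forall>i\<le>d. prime_ideal R (c i) \<and> p \<subseteq> c i) \<and> (\<forall>i<d. c i \<subset> c (Suc i))"

definition krull_dim_quot :: "'a::field set \<Rightarrow> 'a set \<Rightarrow> nat \<Rightarrow> bool" where
  "krull_dim_quot R p d \<longleftrightarrow> (\<exists>c. prime_chain R p d c) \<and> (\<forall>m c. prime_chain R p m c \<longrightarrow> m \<le> d)"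

definition regular_local_quot :: "'a::field set \<Rightarrow> 'a set \<Rightarrow> bool" where
  "regular_local_quot R p \<longleftrightarrow>
     (\<exists>d G. krull_dim_quot R p d \<and> finite G \<and> card G = d \<and> G \<subseteq> R \<and>
        max_ideal R = {x + y | x y. x \<in> p \<and> y \<in> lspan (*) R G})"

section \<open>Surfaces\<close>

text \<open>
  \<open>S\<close> is the closed subvariety of projective \<open>N\<close>-space with generic point \<open>(x 0 : \<dots> : x N)\<close>; that
  \<open>UNIV\<close> is a point says that its function field is all of \<open>'a\<close>.
\<close>

definition projective_variety :: "('k::field \<Rightarrow> 'a::field) \<Rightarrow> 'a set set \<Rightarrow> bool" where
  "projective_variety \<iota> S \<longleftrightarrow> UNIV \<in> S \<and>
     (\<exists>(N::nat) x. (\<exists>i\<le>N. x i \<noteq> 0) \<and>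
        S = (\<Union>i\<in>{i. i \<le> N \<and> x i \<noteq> 0}. spec (alg_gen \<iota> {x j / x i | j. j \<le> N})))"

definition nonsingular :: "'a::field set set \<Rightarrow> bool" where
  "nonsingular S \<longleftrightarrow> (\<forall>P\<in>S. regular_local_quot P {0})"

definition eval1 :: "('k::field \<Rightarrow> 'a::field) \<Rightarrow> 'k poly \<Rightarrow> 'a \<Rightarrow> 'a" where
  "eval1 \<iota> q s = poly (map_poly \<iota> q) s"

definition eval2 :: "('k::field \<Rightarrow> 'a::field) \<Rightarrow> 'k poly poly \<Rightarrow> 'a \<Rightarrow> 'a \<Rightarrow> 'a" where
  "eval2 \<iota> q s t = poly (map_poly (\<lambda>r. eval1 \<iota> r s) q) t"

text \<open>The function field is purely transcendental of degree two over the base field.\<close>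

definition rational_function_field2 :: "('k::field \<Rightarrow> 'a::field) \<Rightarrow> bool" where
  "rational_function_field2 \<iota> \<longleftrightarrow>
     (\<exists>s t. (\<forall>q. q \<noteq> 0 \<longrightarrow> eval2 \<iota> q s t \<noteq> 0) \<and>
        (\<forall>x. \<exists>q r. r \<noteq> 0 \<and> x = eval2 \<iota> q s t / eval2 \<iota> r s t))"

definition rational_surface :: "('k::field \<Rightarrow> 'a::field) \<Rightarrow> 'a set set \<Rightarrow> bool" where
  "rational_surface \<iota> S \<longleftrightarrow>
     projective_variety \<iota> S \<and> nonsingular S \<and> rational_function_field2 \<iota>"

text \<open>
  A finitely generated subalgebra all of whose localizations are points of \<open>S\<close> has an open
  immersion of its spectrum into \<open>S\<close>, and every affine open subset of \<open>S\<close> is of this form.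
\<close>

definition affine_open :: "('k::field \<Rightarrow> 'a::field) \<Rightarrow> 'a set set \<Rightarrow> 'a set \<Rightarrow> bool" where
  "affine_open \<iota> S R \<longleftrightarrow> (\<exists>X. finite X \<and> R = alg_gen \<iota> X) \<and> spec R \<subseteq> S"

section \<open>Divisors\<close>

definition prime_divisors :: "'a::field set set \<Rightarrow> 'a set set" where
  "prime_divisors S = {P \<in> S. krull_dim_quot P {0} 1}"

definition point_closure :: "'a::field set set \<Rightarrow> 'a set \<Rightarrow> 'a set set" where
  "point_closure S P = {Q \<in> S. Q \<subseteq> P}"

definition uniformizer :: "'a::field set \<Rightarrow> 'a \<Rightarrow> bool" where
  "uniformizer P t \<longleftrightarrow> t \<noteq> 0 \<and> max_ideal P = {t * x | x. x \<in> P}"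

definition ord_at :: "'a::field set \<Rightarrow> 'a \<Rightarrow> int" where
  "ord_at P x = (THE n. \<exists>t u. uniformizer P t \<and> u \<in> P - max_ideal P \<and> x = t powi n * u)"

definition divisor :: "'a::field set set \<Rightarrow> ('a set \<Rightarrow> int) \<Rightarrow> bool" where
  "divisor S D \<longleftrightarrow> {P. D P \<noteq> 0} \<subseteq> prime_divisors S \<and> finite {P. D P \<noteq> 0}"

definition effective :: "('a set \<Rightarrow> int) \<Rightarrow> bool" where
  "effective D \<longleftrightarrow> (\<forall>P. D P \<ge> 0)"

definition principal_divisor :: "'a::field set set \<Rightarrow> 'a \<Rightarrow> 'a set \<Rightarrow> int" where
  "principal_divisor S x = (\<lambda>P. if P \<in> prime_divisors S then ord_at P x else 0)"

definition linear_system :: "'a::field set set \<Rightarrow> ('a set \<Rightarrow> int) \<Rightarrow> ('a set \<Rightarrow> int) set" where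
  "linear_system S D = {E. divisor S E \<and> effective E \<and>
     (\<exists>x. x \<noteq> 0 \<and> E = (\<lambda>P. D P + principal_divisor S x P))}"

text \<open>The function \<open>x\<close> is a local equation of \<open>D\<close> on the open subset \<open>U\<close>.\<close>

definition local_equation :: "'a::field set set \<Rightarrow> 'a set set \<Rightarrow> ('a set \<Rightarrow> int) \<Rightarrow> 'a \<Rightarrow> bool" where
  "local_equation S U D x \<longleftrightarrow> x \<noteq> 0 \<and> (\<forall>P \<in> U \<inter> prime_divisors S. ord_at P x = D P)"

text \<open>
  \<open>\<O>(D)\<close> is generated on \<open>spec (R i)\<close> by the inverse of a local equation \<open>l i\<close> of \<open>D\<close>, so the
  coordinates of a section transform by \<open>l i / l j\<close>. The choice of \<open>D\<close> within its class is
  immaterial.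
\<close>

definition line_bundle_cocycle ::
  "'a::field set set \<Rightarrow> 'i set \<Rightarrow> ('i \<Rightarrow> 'a set) \<Rightarrow> ('a set \<Rightarrow> int) \<Rightarrow> ('i \<Rightarrow> 'i \<Rightarrow> 'a) \<Rightarrow> bool" where
  "line_bundle_cocycle S I R D c \<longleftrightarrow>
     (\<exists>l. (\<forall>i\<in>I. local_equation S (spec (R i)) D (l i)) \<and> (\<forall>i\<in>I. \<forall>j\<in>I. c i j = l i / l j))"

section \<open>Rational differential forms\<close>

text \<open>
  Forms are given by generators and relations: \<open>Poly_Mapping.single x a\<close> stands for \<open>a dx\<close>, and
  \<open>Poly_Mapping.single (x, y) a\<close> for \<open>a dx \<and> dy\<close>. A rational form is a class of the free module
  modulo the submodule of relations.
\<close>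

definition fscale :: "'a::field \<Rightarrow> ('b \<Rightarrow>\<^sub>0 'a) \<Rightarrow> ('b \<Rightarrow>\<^sub>0 'a)" where
  "fscale a u = Poly_Mapping.map (\<lambda>x. a * x) u"

definition form_relations1 :: "('k::field \<Rightarrow> 'a::field) \<Rightarrow> ('a \<Rightarrow>\<^sub>0 'a) set" where
  "form_relations1 \<iota> = lspan fscale UNIV
     ({Poly_Mapping.single (x + y) 1 - Poly_Mapping.single x 1 - Poly_Mapping.single y 1 | x y. True} \<union>
      {Poly_Mapping.single (x * y) 1 - Poly_Mapping.single y x - Poly_Mapping.single x y | x y. True} \<union>
      {Poly_Mapping.single (\<iota> c) 1 | c. True})"

definition form_relations2 :: "('k::field \<Rightarrow> 'a::field) \<Rightarrow> ('a \<times> 'a \<Rightarrow>\<^sub>0 'a) set" where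
  "form_relations2 \<iota> = lspan fscale UNIV
     ({Poly_Mapping.single (x + y, z) 1 - Poly_Mapping.single (x, z) 1
         - Poly_Mapping.single (y, z) 1 | x y z. True} \<union>
      {Poly_Mapping.single (z, x + y) 1 - Poly_Mapping.single (z, x) 1
         - Poly_Mapping.single (z, y) 1 | x y z. True} \<union>
      {Poly_Mapping.single (x * y, z) 1 - Poly_Mapping.single (y, z) x
         - Poly_Mapping.single (x, z) y | x y z. True} \<union>
      {Poly_Mapping.single (z, x * y) 1 - Poly_Mapping.single (z, y) x
         - Poly_Mapping.single (z, x) y | x y z. True} \<union>
      {Poly_Mapping.single (\<iota> c, z) 1 | c z. True} \<union>
      {Poly_Mapping.single (z, \<iota> c) 1 | c z. True} \<union>
      {Poly_Mapping.single (z, z) 1 | z. True})"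

definition form_class :: "('b \<Rightarrow>\<^sub>0 'a::field) set \<Rightarrow> ('b \<Rightarrow>\<^sub>0 'a) \<Rightarrow> ('b \<Rightarrow>\<^sub>0 'a) set" where
  "form_class N u = {v. v - u \<in> N}"

text \<open>
  For a generating set \<open>G\<close> of the module of forms regular at \<open>P\<close>, the order of a rational form at \<open>P\<close>
  is the largest \<open>n\<close> such that the form is \<open>t\<^sup>n\<close> times a form regular at \<open>P\<close>, \<open>t\<close> a uniformizer.
\<close>

definition form_ord :: "'a::field set \<Rightarrow> ('b \<Rightarrow>\<^sub>0 'a) set \<Rightarrow> ('b \<Rightarrow>\<^sub>0 'a) set \<Rightarrow> int" where
  "form_ord P G \<omega> =
     (GREATEST n. \<exists>t. uniformizer P t \<and> (\<exists>v \<in> lspan fscale P G. fscale (t powi n) v \<in> \<omega>))"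

definition form_divisor1 :: "'a::field set set \<Rightarrow> ('a \<Rightarrow>\<^sub>0 'a) set \<Rightarrow> 'a set \<Rightarrow> int" where
  "form_divisor1 S \<omega> = (\<lambda>P. if P \<in> prime_divisors S
     then form_ord P {Poly_Mapping.single x 1 | x. x \<in> P} \<omega> else 0)"

definition form_divisor2 :: "'a::field set set \<Rightarrow> ('a \<times> 'a \<Rightarrow>\<^sub>0 'a) set \<Rightarrow> 'a set \<Rightarrow> int" where
  "form_divisor2 S \<omega> = (\<lambda>P. if P \<in> prime_divisors S
     then form_ord P {Poly_Mapping.single (x, y) 1 | x y. x \<in> P \<and> y \<in> P} \<omega> else 0)"

definition canonical_divisor ::
  "('k::field \<Rightarrow> 'a::field) \<Rightarrow> 'a set set \<Rightarrow> ('a set \<Rightarrow> int) \<Rightarrow> bool" where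
  "canonical_divisor \<iota> S D \<longleftrightarrow> divisor S D \<and>
     (\<exists>u. u \<notin> form_relations2 \<iota> \<and> D = form_divisor2 S (form_class (form_relations2 \<iota>) u))"

section \<open>Coble surfaces\<close>

text \<open>
  The curve on \<open>S\<close> with generic point \<open>P\<close> has the local rings \<open>Q/(\<mm>\<^sub>P \<inter> Q)\<close>, and function field
  \<open>P/\<mm>\<^sub>P\<close>, which is required to be \<open>'k(s)\<close> with \<open>s\<close> transcendental.
\<close>

definition nonsingular_rational_curve ::
  "('k::field \<Rightarrow> 'a::field) \<Rightarrow> 'a set set \<Rightarrow> 'a set \<Rightarrow> bool" where
  "nonsingular_rational_curve \<iota> S P \<longleftrightarrow> P \<in> prime_divisors S \<and>
     (\<forall>Q \<in> point_closure S P. regular_local_quot Q (max_ideal P \<inter> Q)) \<and>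
     (\<exists>s\<in>P. (\<forall>q. q \<noteq> 0 \<longrightarrow> eval1 \<iota> q s \<notin> max_ideal P) \<and>
        (\<forall>x\<in>P. \<exists>q r. r \<noteq> 0 \<and> x * eval1 \<iota> r s - eval1 \<iota> q s \<in> max_ideal P))"

definition boundary_divisor :: "nat \<Rightarrow> (nat \<Rightarrow> 'a set) \<Rightarrow> 'a set \<Rightarrow> int" where
  "boundary_divisor n C = (\<lambda>P. \<Sum>i=1..n. if P = C i then 1 else 0)"

definition coble_surface ::
  "('k::field \<Rightarrow> 'a::field) \<Rightarrow> 'a set set \<Rightarrow> nat \<Rightarrow> (nat \<Rightarrow> 'a set) \<Rightarrow> bool" where
  "coble_surface \<iota> S n C \<longleftrightarrow> rational_surface \<iota> S \<and>
     (\<exists>K. canonical_divisor \<iota> S K \<and> linear_system S (\<lambda>P. - K P) = {} \<and>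
        linear_system S (\<lambda>P. - 2 * K P) = {boundary_divisor n C}) \<and>
     (\<forall>i\<in>{1..n}. nonsingular_rational_curve \<iota> S (C i)) \<and>
     (\<forall>i\<in>{1..n}. \<forall>j\<in>{1..n}. i \<noteq> j \<longrightarrow> point_closure S (C i) \<inter> point_closure S (C j) = {})"

section \<open>The canonical covering, the bi-conductrix and the conductrix\<close>

text \<open>
  The data from which the canonical covering is glued: an affine open covering \<open>spec (R i)\<close>, local
  equations \<open>f i\<close> of the boundary, a cocycle \<open>c\<close> of \<open>\<O>(-K)\<close> and units \<open>g i\<close>. The condition on
  \<open>(c i j)\<^sup>2\<close> is what makes \<open>z\<^sub>i \<mapsto> c i j z\<^sub>j\<close> compatible with \<open>z\<^sub>i\<^sup>2 = f i * g i\<close>.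
\<close>

definition canonical_covering_data ::
  "('k::field \<Rightarrow> 'a::field) \<Rightarrow> 'a set set \<Rightarrow> nat \<Rightarrow> (nat \<Rightarrow> 'a set) \<Rightarrow> 'i set \<Rightarrow>
     ('i \<Rightarrow> 'a set) \<Rightarrow> ('i \<Rightarrow> 'a) \<Rightarrow> ('i \<Rightarrow> 'i \<Rightarrow> 'a) \<Rightarrow> ('i \<Rightarrow> 'a) \<Rightarrow> bool" where
  "canonical_covering_data \<iota> S n C I R f c g \<longleftrightarrow>
     (\<forall>i\<in>I. affine_open \<iota> S (R i)) \<and> S = (\<Union>i\<in>I. spec (R i)) \<and>
     (\<forall>i\<in>I. f i \<in> R i \<and> local_equation S (spec (R i)) (boundary_divisor n C) (f i)) \<and>
     (\<exists>K. canonical_divisor \<iota> S K \<and> line_bundle_cocycle S I R (\<lambda>P. - K P) c) \<and>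
     (\<forall>i\<in>I. g i \<noteq> 0 \<and> g i \<in> R i \<and> inverse (g i) \<in> R i) \<and>
     (\<forall>i\<in>I. \<forall>j\<in>I. (c i j)\<^sup>2 = (f i / f j) * (g i / g j))"

definition canonical_one_form ::
  "('k::field \<Rightarrow> 'a::field) \<Rightarrow> 'i set \<Rightarrow> ('i \<Rightarrow> 'a) \<Rightarrow> ('i \<Rightarrow> 'a) \<Rightarrow> ('a \<Rightarrow>\<^sub>0 'a) set \<Rightarrow> bool" where
  "canonical_one_form \<iota> I f g \<eta> \<longleftrightarrow>
     (\<forall>i\<in>I. \<eta> = form_class (form_relations1 \<iota>) (Poly_Mapping.single (f i * g i) (1 / (f i * g i))))"

definition bi_conductrix ::
  "'a::field set set \<Rightarrow> nat \<Rightarrow> (nat \<Rightarrow> 'a set) \<Rightarrow> ('a \<Rightarrow>\<^sub>0 'a) set \<Rightarrow> ('a set \<Rightarrow> int) \<Rightarrow> bool" where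
  "bi_conductrix S n C \<eta> B \<longleftrightarrow> divisor S B \<and> effective B \<and>
     form_divisor1 S \<eta> = (\<lambda>P. - boundary_divisor n C P + B P)"

text \<open>
  Elements of \<open>R[z]/(z\<^sup>2 - F)\<close> are represented by polynomials in \<open>z\<close> of degree less than two with
  coefficients in \<open>R\<close>, i.e. by their remainders. Its total ring of fractions is \<open>'a[z]/(z\<^sup>2 - F)\<close>.
\<close>

definition covering_ring :: "'a::field set \<Rightarrow> 'a poly set" where
  "covering_ring R = {p. degree p < 2 \<and> (\<forall>m. coeff p m \<in> R)}"

text \<open>The integral closure of \<open>R[z]/(z\<^sup>2 - F)\<close> in its total ring of fractions.\<close>

definition normalization_ring :: "'a::field set \<Rightarrow> 'a \<Rightarrow> 'a poly set" where
  "normalization_ring R F = {p. degree p < 2 \<and>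
     (\<exists>Q. lead_coeff Q = 1 \<and> (\<forall>m. coeff Q m \<in> covering_ring R) \<and> [:- F, 0, 1:] dvd poly Q p)}"

text \<open>
  \<open>\<V>\<close> is a refinement of the affine covering \<open>R\<close> on which the normalization is free with basis
  \<open>1, w\<close>. Over \<open>V\<close> the covering is \<open>V[z]/(z\<^sup>2 - F)\<close> with \<open>F = f i * g i\<close>, and \<open>z = [:0, 1:]\<close>. That the
  sum \<open>V + V w\<close> is direct follows from \<open>z = b + a w\<close>.
\<close>

definition conductrix ::
  "('k::field \<Rightarrow> 'a::field) \<Rightarrow> 'a set set \<Rightarrow> 'i set \<Rightarrow> ('i \<Rightarrow> 'a set) \<Rightarrow> ('i \<Rightarrow> 'a) \<Rightarrow> ('i \<Rightarrow> 'a) \<Rightarrow>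
     ('a set \<Rightarrow> int) \<Rightarrow> bool" where
  "conductrix \<iota> S I R f g A \<longleftrightarrow> divisor S A \<and> effective A \<and>
     (\<exists>\<V>. (\<forall>V\<in>\<V>. affine_open \<iota> S V) \<and> S = (\<Union>V\<in>\<V>. spec V) \<and>
        (\<forall>V\<in>\<V>. \<exists>i\<in>I. spec V \<subseteq> spec (R i) \<and>
           (\<exists>w. \<exists>h\<in>V. \<exists>a\<in>V. \<exists>b\<in>V.
              normalization_ring V (f i * g i) = {[:x:] + smult y w | x y. x \<in> V \<and> y \<in> V} \<and>
              [:- (f i * g i), 0, 1:] dvd w * w - [:h:] \<and>
              [:0, 1:] = [:b:] + smult a w \<and>
              local_equation S (spec V) A a)))"

end

theory Submission
  imports Defs
begin

text \<open>
  At the generic point \<open>P\<close> of a curve write \<open>F = f g\<close> for the local equation of the covering. In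
  characteristic two, \<open>z = b + a w\<close> and \<open>w\<^sup>2 = h\<close> give \<open>F = a\<^sup>2 h + b\<^sup>2\<close>, hence \<open>\<eta> = dF / F = a\<^sup>2 dh / F\<close>, and
  everything reduces to the claim that \<open>dh\<close> does not vanish at \<open>P\<close>. This is witnessed by a
  derivation of the function field that maps the valuation ring \<open>P\<close> into itself and \<open>h\<close> to a unit.
  Normality says that \<open>h\<close> is not of the form \<open>s\<^sup>2 + t\<^sup>2 y\<close> with \<open>s, y \<in> P\<close> and \<open>t\<close> a uniformizer. So either
  \<open>h\<close> is not a square in the residue field, or \<open>h - s\<^sup>2\<close> is a uniformizer for some \<open>s\<close>. In both
  cases \<open>h\<close>, up to a square, is part of a pair \<open>u, v\<close>, one of them a uniformizer and the other a
  nonsquare in the residue field, such that \<open>P\<close> is free over its subring of squares with basis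
  \<open>1, u, v, uv\<close>, and the derivation is a coefficient function of this basis.
\<close>

section \<open>Two-bases and derivations in characteristic two\<close>

definition derivation :: "('k::field \<Rightarrow> 'a::field) \<Rightarrow> ('a \<Rightarrow> 'a) \<Rightarrow> bool" where
  "derivation \<iota> D \<longleftrightarrow> (\<forall>x y. D (x + y) = D x + D y) \<and> (\<forall>x y. D (x * y) = x * D y + y * D x) \<and>
     (\<forall>c. D (\<iota> c) = 0)"

text \<open>The general element of the span of \<open>1, u, v, u * v\<close> over the subfield of
  squares. The arguments are square roots of the coefficients, so they range over the whole
  field.\<close>

definition sq_comb :: "'a::field \<Rightarrow> 'a \<Rightarrow> 'a \<Rightarrow> 'a \<Rightarrow> 'a \<Rightarrow> 'a \<Rightarrow> 'a" where
  "sq_comb u v a b c d = a\<^sup>2 + b\<^sup>2 * u + c\<^sup>2 * v + d\<^sup>2 * u * v"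

text \<open>Together with \<open>two_spanning\<close> this makes \<open>u, v\<close> a 2-basis of
  the field, that is, a p-basis for p = 2.\<close>

definition two_independent :: "'a::field \<Rightarrow> 'a \<Rightarrow> bool" where
  "two_independent u v \<longleftrightarrow>
     (\<forall>a b c d. sq_comb u v a b c d = 0 \<longrightarrow> a = 0 \<and> b = 0 \<and> c = 0 \<and> d = 0)"

definition two_spanning :: "'a::field \<Rightarrow> 'a \<Rightarrow> bool" where
  "two_spanning u v \<longleftrightarrow> (\<forall>x. \<exists>a b c d. x = sq_comb u v a b c d)"

lemma sq_comb_swap: "sq_comb u v a b c d = sq_comb v u a c b d"
  by (simp add: sq_comb_def)

lemma two_independent_swap: "two_independent u v \<Longrightarrow> two_independent v u"
  unfolding two_independent_def by (subst sq_comb_swap) blast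

lemma two_spanning_swap: "two_spanning u v \<Longrightarrow> two_spanning v u"
  unfolding two_spanning_def by (metis sq_comb_swap)

lemma sq_comb_scale: "sq_comb u v (e * a) (e * b) (e * c) (e * d) = e\<^sup>2 * sq_comb u v a b c d"
  by (simp add: sq_comb_def power_mult_distrib algebra_simps)

context
  assumes two: "(2 :: 'a::field) = 0"
begin

lemma four_zero: "(4 :: 'a) = 0"
proof -
  have "(4 :: 'a) = 2 * 2" by simp
  then show ?thesis by (simp only: two mult_zero_left)
qed

lemma double_zero: "x + x = (0 :: 'a)"
  using two by (metis mult_2 mult_zero_left)

lemma uminus_eq: "- x = (x :: 'a)"
  using double_zero by (simp add: eq_neg_iff_add_eq_0 add_eq_0_iff)

lemma diff_eq_add: "x - y = x + (y :: 'a)"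
  using uminus_eq[of y] by (metis diff_conv_add_uminus)

lemma square_add: "(x + y)\<^sup>2 = x\<^sup>2 + (y :: 'a)\<^sup>2"
  by (simp add: power2_sum two)

lemma sq_comb_add:
  "sq_comb u v (a + a') (b + b') (c + c') (d + d' :: 'a) =
     sq_comb u v a b c d + sq_comb u v a' b' c' d'"
  by (simp add: sq_comb_def square_add algebra_simps)

text \<open>The span is a subring: squares of \<open>u\<close> and \<open>v\<close> that arise in a
  product are absorbed into the coefficients, and squaring a sum produces no cross terms.\<close>

lemma sq_comb_mult:
  "sq_comb u v a b c d * sq_comb u v a' b' c' (d' :: 'a) =
     sq_comb u v (a * a' + b * b' * u + c * c' * v + d * d' * u * v)
       (a * b' + b * a' + c * d' * v + d * c' * v)
       (a * c' + c * a' + b * d' * u + d * b' * u) (a * d' + d * a' + b * c' + c * b')"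
  by (simp add: sq_comb_def square_add algebra_simps power2_eq_square four_zero)

lemma derivation_square:
  assumes "derivation \<iota> D"
  shows "D (x\<^sup>2) = (0 :: 'a)"
  using assms by (simp add: derivation_def power2_eq_square double_zero)

lemma two_independent_inj:
  assumes "two_independent u v" and "sq_comb u v a b c d = sq_comb u v a' b' c' (d' :: 'a)"
  shows "a = a' \<and> b = b' \<and> c = c' \<and> d = d'"
proof -
  have "sq_comb u v (a + a') (b + b') (c + c') (d + d') = 0"
    using assms(2) by (simp add: sq_comb_add double_zero)
  then have "a + a' = 0 \<and> b + b' = 0 \<and> c + c' = 0 \<and> d + d' = 0"
    using assms(1) unfolding two_independent_def by blast
  then show ?thesis
    by (simp add: add_eq_0_iff uminus_eq)
qed

text \<open>This is the partial derivative in \<open>v\<close>, with \<open>u\<close> and all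
  squares held constant. It kills the ground field because \<open>sq\<close> makes its elements
  squares.\<close>

lemma two_basis_derivation:
  fixes \<iota> :: "'k::field \<Rightarrow> 'a"
  assumes ind: "two_independent u v" and span: "two_spanning u v"
    and sq: "\<forall>c. \<exists>e. \<iota> c = e\<^sup>2"
  shows "\<exists>D. derivation \<iota> D \<and> (\<forall>a b c d. D (sq_comb u v a b c d) = c\<^sup>2 + d\<^sup>2 * u)"
proof -
  obtain \<alpha> \<beta> \<gamma> \<delta> where e: "\<And>x. x = sq_comb u v (\<alpha> x) (\<beta> x) (\<gamma> x) (\<delta> x)"
    using span unfolding two_spanning_def by metis
  define D where "D x = (\<gamma> x)\<^sup>2 + (\<delta> x)\<^sup>2 * u" for x
  have D: "D (sq_comb u v a b c d) = c\<^sup>2 + d\<^sup>2 * u" for a b c d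
    using two_independent_inj[OF ind e[of "sq_comb u v a b c d"]] by (simp add: D_def)
  have "derivation \<iota> D"
    unfolding derivation_def
  proof (intro conjI allI)
    fix x y
    show "D (x + y) = D x + D y"
      by (subst (1 2) e) (simp only: sq_comb_add[symmetric] D, simp add: D_def square_add algebra_simps)
    show "D (x * y) = x * D y + y * D x"
    proof -
      define a b c d where "a = \<alpha> x" and "b = \<beta> x" and "c = \<gamma> x" and "d = \<delta> x"
      define a' b' c' d' where "a' = \<alpha> y" and "b' = \<beta> y" and "c' = \<gamma> y" and "d' = \<delta> y"
      have x: "x = sq_comb u v a b c d" and y: "y = sq_comb u v a' b' c' d'"
        using e unfolding a_def b_def c_def d_def a'_def b'_def c'_def d'_def by blast+
      \<comment> \<open>Cancels pairs of equal summands once the Leibniz identity is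
        expanded.\<close>
      have 1: "z + (z + w) = w" for z w :: 'a
        by (simp add: double_zero flip: add.assoc)
      show ?thesis
        unfolding x y sq_comb_mult D
        by (simp add: sq_comb_def square_add algebra_simps power2_eq_square 1
            double_zero)
    qed
  next
    fix c
    obtain e' where e': "\<iota> c = e'\<^sup>2" using sq by blast
    have "\<iota> c = sq_comb u v e' 0 0 0" by (simp add: sq_comb_def e')
    then show "D (\<iota> c) = 0" using D by simp
  qed
  with D show ?thesis by blast
qed

text \<open>
  Spanning and independence over the subfield of squares are those of the vector space whose
  scalars act through the Frobenius, so the dimension bound of the library applies.
\<close>

lemma two_independent_spanning:
  assumes span: "two_spanning s (t :: 'a)" and ind: "two_independent u (v :: 'a)"
  shows "two_spanning u v"
proof -
  interpret vs: vector_space "\<lambda>a x. a\<^sup>2 * (x :: 'a)"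
    by unfold_locales (auto simp: algebra_simps square_add)
  have span4: "x \<in> vs.span {1, u, v, u * v} \<longleftrightarrow> (\<exists>a b c d. x = sq_comb u v a b c d)" for x u v
  proof
    assume "x \<in> vs.span {1, u, v, u * v}"
    then obtain a b c d where "x - a\<^sup>2 * 1 - b\<^sup>2 * u - c\<^sup>2 * v - d\<^sup>2 * (u * v) = 0"
      by (auto simp: vs.span_breakdown_eq)
    then show "\<exists>a b c d. x = sq_comb u v a b c d"
      by (intro exI[of _ a] exI[of _ b] exI[of _ c] exI[of _ d])
        (simp add: sq_comb_def algebra_simps)
  next
    assume "\<exists>a b c d. x = sq_comb u v a b c d"
    then obtain a b c d where "x = a\<^sup>2 * 1 + b\<^sup>2 * u + c\<^sup>2 * v + d\<^sup>2 * (u * v)"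
      by (auto simp: sq_comb_def mult.assoc)
    then show "x \<in> vs.span {1, u, v, u * v}"
      by (simp only:) (intro vs.span_add vs.span_scale vs.span_base; simp)
  qed
  have i: "sq_comb u v a b c d = 0 \<Longrightarrow> a = 0 \<and> b = 0 \<and> c = 0 \<and> d = 0" for a b c d
    using ind unfolding two_independent_def by blast
  \<comment> \<open>The basis is built one vector at a time; a dependence at any later stage would
    be a vanishing \<open>sq_comb\<close> with a coefficient 1.\<close>
  have n1: "1 \<notin> vs.span {}" by simp
  have n2: "u \<notin> vs.span {1}"
  proof
    assume "u \<in> vs.span {1}"
    then obtain a where "u - a\<^sup>2 = 0" by (auto simp: vs.span_breakdown_eq)
    then show False using i[of a 1 0 0] by (simp add: sq_comb_def double_zero)
  qed
  have n3: "v \<notin> vs.span {u, 1}"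
  proof
    assume "v \<in> vs.span {u, 1}"
    then obtain a b where "v - b\<^sup>2 * u - a\<^sup>2 = 0" by (auto simp: vs.span_breakdown_eq)
    then have "v = b\<^sup>2 * u + a\<^sup>2" by (simp add: algebra_simps)
    then have "sq_comb u v a b 1 0 = (a\<^sup>2 + b\<^sup>2 * u) + (a\<^sup>2 + b\<^sup>2 * u)"
      by (simp add: sq_comb_def algebra_simps)
    then show False using i[of a b 1 0] by (simp add: double_zero)
  qed
  have n4: "u * v \<notin> vs.span {v, u, 1}"
  proof
    assume "u * v \<in> vs.span {v, u, 1}"
    then obtain a b c where "u * v - c\<^sup>2 * v - b\<^sup>2 * u - a\<^sup>2 = 0"
      by (auto simp: vs.span_breakdown_eq)
    then have "u * v = c\<^sup>2 * v + b\<^sup>2 * u + a\<^sup>2" by (simp add: algebra_simps)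
    then have "sq_comb u v a b c 1 = (a\<^sup>2 + b\<^sup>2 * u + c\<^sup>2 * v) + (a\<^sup>2 + b\<^sup>2 * u + c\<^sup>2 * v)"
      by (simp add: sq_comb_def algebra_simps)
    then show False using i[of a b c 1] by (simp add: double_zero)
  qed
  let ?B = "{u * v, v, u, 1}"
  have indep: "vs.independent ?B"
    by (intro vs.independent_insertI n1 n2 n3 n4 vs.independent_empty)
  have card: "card ?B = 4"
  proof -
    have "u \<notin> {1}" "v \<notin> {u, 1}" "u * v \<notin> {v, u, 1}"
      by (rule contrapos_nn[OF n2 vs.span_base], assumption,
          rule contrapos_nn[OF n3 vs.span_base], assumption,
          rule contrapos_nn[OF n4 vs.span_base], assumption)
    then show ?thesis
      by (simp only: card_insert_disjoint finite.intros card.empty not_False_eq_True empty_iff)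
  qed
  have UNIV: "vs.span {1, s, t, s * t} = UNIV"
    using span unfolding two_spanning_def span4[of _ s t, symmetric] by blast
  show ?thesis
    unfolding two_spanning_def
  proof
    fix x
    \<comment> \<open>Otherwise \<open>x\<close> would give five independent vectors in a space
      spanned by at most four.\<close>
    have "x \<in> vs.span ?B"
    proof (rule ccontr)
      assume x: "x \<notin> vs.span ?B"
      then have "x \<notin> ?B" by (metis vs.span_base)
      then have "card (insert x ?B) = 5" using card by (subst card_insert_disjoint) auto
      moreover have "card (insert x ?B) \<le> card {1, s, t, s * t}"
        using vs.independent_span_bound[of "{1, s, t, s * t}" "insert x ?B"]
          vs.independent_insertI[OF x indep] UNIV by simp
      moreover have "card {1, s, t, s * t} \<le> 4"
        using card_length[of "[1, s, t, s * t]"] by simp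
      ultimately show False by linarith
    qed
    moreover have "?B = {1, u, v, u * v}" by blast
    ultimately show "\<exists>a b c d. x = sq_comb u v a b c d" using span4 by metis
  qed
qed

end

section \<open>Rational function fields in two variables\<close>

definition hom_on :: "('b::comm_ring_1 \<Rightarrow> 'a::field) \<Rightarrow> bool" where
  "hom_on \<phi> \<longleftrightarrow> \<phi> 0 = 0 \<and> (\<forall>x y. \<phi> (x + y) = \<phi> x + \<phi> y \<and> \<phi> (x * y) = \<phi> x * \<phi> y)"

text \<open>The coefficient ring is arbitrary so that the lemma can be iterated: applied to
  \<open>\<iota>\<close> it handles \<open>eval1\<close>, applied to \<open>eval1\<close> it handles
  \<open>eval2\<close>.\<close>

lemma hom_on_poly:
  assumes "hom_on \<phi>"
  shows "hom_on (\<lambda>q. poly (map_poly \<phi> q) x)"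
proof -
  have 0: "\<phi> 0 = 0" and a: "\<And>x y. \<phi> (x + y) = \<phi> x + \<phi> y" and m: "\<And>x y. \<phi> (x * y) = \<phi> x * \<phi> y"
    using assms by (auto simp: hom_on_def)
  have add: "map_poly \<phi> (p + q) = map_poly \<phi> p + map_poly \<phi> q" for p q
    by (rule poly_eqI) (simp add: coeff_map_poly 0 a)
  have mult: "poly (map_poly \<phi> (p * q)) x = poly (map_poly \<phi> p) x * poly (map_poly \<phi> q) x" for p q
  proof (induction p)
    case (pCons c p)
    have "map_poly \<phi> (pCons c p * q) = smult (\<phi> c) (map_poly \<phi> q) + pCons 0 (map_poly \<phi> (p * q))"
      by (simp add: add map_poly_smult map_poly_pCons 0 m)
    with pCons show ?case
      by (simp add: map_poly_pCons 0 algebra_simps)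
  qed simp
  show ?thesis
    by (simp add: hom_on_def add mult)
qed

lemma field_embedding_hom_on: "field_embedding \<iota> \<Longrightarrow> hom_on \<iota>"
  unfolding field_embedding_def hom_on_def by (metis add_cancel_right_left)

lemma field_embedding_two:
  fixes \<iota> :: "'k::field \<Rightarrow> 'a::field"
  assumes "CHAR('k) = 2" and "field_embedding \<iota>"
  shows "(2 :: 'a) = 0"
proof -
  have "of_nat CHAR('k) = (0 :: 'k)" by (rule of_nat_CHAR)
  then have "(1 :: 'k) + 1 = 0" using assms(1) by simp
  moreover have "\<iota> 0 = 0" using field_embedding_hom_on[OF assms(2)] by (simp add: hom_on_def)
  ultimately have "\<iota> 1 + \<iota> 1 = 0" using assms(2) unfolding field_embedding_def by metis
  then show ?thesis using assms(2) by (simp add: field_embedding_def)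
qed

text \<open>Square roots exist in an algebraically closed field. This puts the ground field among
  the squares, on which derivations in characteristic two vanish.\<close>

lemma field_embedding_square:
  fixes \<iota> :: "'k::alg_closed_field \<Rightarrow> 'a::field"
  assumes "field_embedding \<iota>"
  shows "\<exists>e. \<iota> c = e\<^sup>2"
proof -
  obtain y where "y ^ 2 = c" using nth_root_exists[of 2 c] by auto
  then have "\<iota> c = (\<iota> y)\<^sup>2"
    using assms by (auto simp: field_embedding_def power2_eq_square)
  then show ?thesis ..
qed

lemma hom_on_eval1: "field_embedding \<iota> \<Longrightarrow> hom_on (\<lambda>q. eval1 \<iota> q s)"
  unfolding eval1_def by (intro hom_on_poly field_embedding_hom_on)

lemma hom_on_eval2: "field_embedding \<iota> \<Longrightarrow> hom_on (\<lambda>q. eval2 \<iota> q s t)"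
  unfolding eval2_def by (intro hom_on_poly hom_on_eval1)

lemma pderiv_square_char_2:
  fixes p :: "'b::idom poly"
  assumes "CHAR('b) = 2"
  shows "pderiv (p\<^sup>2) = 0"
proof -
  have "CHAR('b poly) = 2" using assms by simp
  then have "p * pderiv p + p * pderiv p = 0"
    by (metis uminus_CHAR_2 add.right_inverse)
  then show ?thesis
    by (simp only: power2_eq_square pderiv_mult)
qed

text \<open>A parity argument: \<open>[:[:0, 1:]:]\<close> is the inner variable, and for nonzero
  \<open>D\<close> the inner degree of the leading coefficient would be even on the left and odd on
  the right.\<close>

lemma square_ne_odd_square:
  fixes C D :: "'b::idom poly poly"
  assumes "C\<^sup>2 = D\<^sup>2 * [:[:0, 1:]:]"
  shows "D = 0"
proof (rule ccontr)
  assume D: "D \<noteq> 0"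
  then have C: "C \<noteq> 0" using assms by auto
  have "lead_coeff (C\<^sup>2) = lead_coeff (D\<^sup>2 * [:[:0, 1:]:])" using assms by simp
  then have "(lead_coeff C)\<^sup>2 = (lead_coeff D)\<^sup>2 * [:0, 1:]"
    by (simp only: lead_coeff_mult lead_coeff_power lead_coeff_pCons(2))
  then have "degree ((lead_coeff C)\<^sup>2) = degree ((lead_coeff D)\<^sup>2 * [:0, 1:])" by simp
  also have "\<dots> = degree ((lead_coeff D)\<^sup>2) + 1"
    using D by (subst degree_mult_eq) auto
  finally show False
    using C D by (simp add: degree_power_eq) presburger
qed

text \<open>Differentiating in the outer variable kills the \<open>A\<close> and \<open>B\<close>
  terms and isolates a relation between \<open>C\<close> and \<open>D\<close>; parity of the inner
  degree then settles each pair.\<close>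

lemma two_independent_poly:
  fixes A B C D :: "'b::idom poly poly"
  assumes char: "CHAR('b) = 2"
    and eq: "A\<^sup>2 + B\<^sup>2 * [:[:0, 1:]:] + C\<^sup>2 * [:0, 1:] + D\<^sup>2 * [:[:0, 1:]:] * [:0, 1:] = 0"
  shows "A = 0 \<and> B = 0 \<and> C = 0 \<and> D = 0"
proof -
  have char': "CHAR('b poly) = 2" "CHAR('b poly poly) = 2" using char by simp_all
  have neg: "x + y = 0 \<longleftrightarrow> x = y" for x y :: "'b poly poly"
    using uminus_CHAR_2[OF char'(2)] by (metis add_eq_0_iff)
  have dx: "pderiv [:[:0, 1 :: 'b:]:] = 0" by (simp add: pderiv_pCons)
  have dy: "pderiv [:0, 1 :: 'b poly:] = 1" by (simp add: pderiv_pCons one_pCons)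
  have "pderiv (A\<^sup>2 + B\<^sup>2 * [:[:0, 1:]:] + C\<^sup>2 * [:0, 1:] + D\<^sup>2 * [:[:0, 1:]:] * [:0, 1:]) = 0"
    by (simp only: eq pderiv_0)
  then have CD: "C\<^sup>2 + D\<^sup>2 * [:[:0, 1:]:] = 0"
    by (simp only: pderiv_add pderiv_mult pderiv_square_char_2[OF char'(1)] dx dy
        mult_zero_left mult_zero_right mult_1_right add_0_left add_0_right)
  have "A\<^sup>2 + B\<^sup>2 * [:[:0, 1:]:] = A\<^sup>2 + B\<^sup>2 * [:[:0, 1:]:] + (C\<^sup>2 + D\<^sup>2 * [:[:0, 1:]:]) * [:0, 1:]"
    by (simp only: CD mult_zero_left add_0_right)
  also have "\<dots> = 0"
    using eq by (simp only: distrib_right add.assoc)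
  finally have AB: "A\<^sup>2 + B\<^sup>2 * [:[:0, 1:]:] = 0" .
  have "D = 0" using square_ne_odd_square CD neg by blast
  moreover have "B = 0" using square_ne_odd_square AB neg by blast
  ultimately show ?thesis using AB CD by simp
qed

text \<open>The transcendental generators form a 2-basis: independence reduces to polynomials by
  clearing denominators, and spanning uses square roots in the ground field.\<close>

lemma rational_function_field2_two_basis:
  fixes \<iota> :: "'k::alg_closed_field \<Rightarrow> 'a::field"
  assumes char: "CHAR('k) = 2" and emb: "field_embedding \<iota>" and rat: "rational_function_field2 \<iota>"
  obtains s t where "two_independent s (t :: 'a)" "two_spanning s t"
proof -
  note two = field_embedding_two[OF char emb]
  obtain s t where alg_ind: "\<And>q. q \<noteq> 0 \<Longrightarrow> eval2 \<iota> q s t \<noteq> 0"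
    and quot: "\<And>x. \<exists>q r. r \<noteq> 0 \<and> x = eval2 \<iota> q s t / eval2 \<iota> r s t"
    using rat unfolding rational_function_field2_def by metis
  define e where "e q = eval2 \<iota> q s t" for q
  have i0: "\<iota> 0 = 0" and i1: "\<iota> 1 = 1"
    using field_embedding_hom_on[OF emb] emb by (auto simp: hom_on_def field_embedding_def)
  have hom: "e 0 = 0" "e (x + y) = e x + e y" "e (x * y) = e x * e y" for x y
    using hom_on_eval2[OF emb] by (auto simp: hom_on_def e_def)
  have es: "e [:[:0, 1:]:] = s" and et: "e [:0, 1:] = t"
    by (auto simp: e_def eval2_def eval1_def map_poly_pCons i0 i1)
  have "two_independent s t"
    unfolding two_independent_def
  proof (intro allI impI)
    fix a b c d assume 0: "sq_comb s t a b c d = 0"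
    obtain qa ra qb rb qc rc qd rd where r: "ra \<noteq> 0" "rb \<noteq> 0" "rc \<noteq> 0" "rd \<noteq> 0"
      and q: "a = e qa / e ra" "b = e qb / e rb" "c = e qc / e rc" "d = e qd / e rd"
      using quot unfolding e_def by metis
    have er: "e ra \<noteq> 0" "e rb \<noteq> 0" "e rc \<noteq> 0" "e rd \<noteq> 0"
      using r alg_ind unfolding e_def by auto
    define z where "z = e ra * e rb * e rc * e rd"
    define A B C D where "A = qa * rb * rc * rd" and "B = qb * ra * rc * rd"
      and "C = qc * ra * rb * rd" and "D = qd * ra * rb * rc"
    have z: "z \<noteq> 0" "z * a = e A" "z * b = e B" "z * c = e C" "z * d = e D"
      using er by (simp_all add: z_def A_def B_def C_def D_def q hom)
    have "e (A\<^sup>2 + B\<^sup>2 * [:[:0, 1:]:] + C\<^sup>2 * [:0, 1:] + D\<^sup>2 * [:[:0, 1:]:] * [:0, 1:]) =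
        sq_comb s t (e A) (e B) (e C) (e D)"
      by (simp only: hom es et power2_eq_square sq_comb_def)
    also have "\<dots> = z\<^sup>2 * sq_comb s t a b c d"
      by (simp only: z(2-)[symmetric] sq_comb_scale)
    finally have "A\<^sup>2 + B\<^sup>2 * [:[:0, 1:]:] + C\<^sup>2 * [:0, 1:] + D\<^sup>2 * [:[:0, 1:]:] * [:0, 1:] = 0"
      using alg_ind 0 unfolding e_def by auto
    then have "A = 0 \<and> B = 0 \<and> C = 0 \<and> D = 0"
      by (rule two_independent_poly[OF char])
    then show "a = 0 \<and> b = 0 \<and> c = 0 \<and> d = 0"
      using z hom(1) by (metis mult_eq_0_iff)
  qed
  moreover have "two_spanning s t"
  proof -
    \<comment> \<open>\<open>M\<close> is closed under sums and products and contains all squares,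
      \<open>s\<close>, \<open>t\<close> and the constants, hence all polynomials in
      \<open>s\<close> and \<open>t\<close>.\<close>
    define M where "M = {x. \<exists>a b c d. x = sq_comb s t a b c d}"
    have MI: "sq_comb s t a b c d \<in> M" for a b c d
      unfolding M_def by blast
    have ME: "\<exists>a b c d. x = sq_comb s t a b c d" if "x \<in> M" for x
      using that unfolding M_def by blast
    have add: "x + y \<in> M" if xy: "x \<in> M" "y \<in> M" for x y
    proof -
      obtain a b c d a' b' c' d' where "x = sq_comb s t a b c d" "y = sq_comb s t a' b' c' d'"
        using ME xy by metis
      then show ?thesis using MI by (simp only: sq_comb_add[OF two, symmetric])
    qed
    have mult: "x * y \<in> M" if xy: "x \<in> M" "y \<in> M" for x y
    proof -
      obtain a b c d a' b' c' d' where "x = sq_comb s t a b c d" "y = sq_comb s t a' b' c' d'"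
        using ME xy by metis
      then show ?thesis using MI by (simp only: sq_comb_mult[OF two])
    qed
    have sq: "x\<^sup>2 \<in> M" for x
      using MI[of x 0 0 0] by (simp add: sq_comb_def)
    have zero: "0 \<in> M" using sq[of 0] by simp
    have "s = sq_comb s t 0 1 0 0" "t = sq_comb s t 0 0 1 0" by (simp_all add: sq_comb_def)
    then have st: "s \<in> M" "t \<in> M" unfolding M_def by blast+
    have c0: "\<iota> c \<in> M" for c using field_embedding_square[OF emb] sq by metis
    have e1: "eval1 \<iota> p s \<in> M" for p
      by (induction p) (simp_all add: eval1_def map_poly_pCons i0 zero add mult st c0)
    have e10: "eval1 \<iota> 0 s = 0" by (simp add: eval1_def)
    have e2: "e p \<in> M" for p
      unfolding e_def
      by (induction p) (simp_all add: eval2_def map_poly_pCons e10 zero add mult st e1)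
    have "x \<in> M" for x
    proof -
      obtain q r where qr: "r \<noteq> 0" "x = e q / e r" using quot unfolding e_def by blast
      \<comment> \<open>Expanding the fraction by \<open>e r\<close> turns its denominator into a
        square.\<close>
      then have "x = e q * e r * (1 / e r)\<^sup>2"
        using alg_ind[of r] by (simp add: e_def power2_eq_square)
      then show ?thesis using mult e2 sq by metis
    qed
    then show ?thesis unfolding two_spanning_def M_def by blast
  qed
  ultimately show ?thesis using that by blast
qed

section \<open>Discrete valuation rings in a field\<close>

locale field_subring =
  fixes P :: "'a::field set"
  assumes zero: "0 \<in> P" and one: "1 \<in> P"
    and add: "x \<in> P \<Longrightarrow> y \<in> P \<Longrightarrow> x + y \<in> P"
    and mult: "x \<in> P \<Longrightarrow> y \<in> P \<Longrightarrow> x * y \<in> P"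
    and uminus: "x \<in> P \<Longrightarrow> - x \<in> P"
begin

lemma diff: "x \<in> P \<Longrightarrow> y \<in> P \<Longrightarrow> x - y \<in> P"
  using add[of x "- y"] uminus by simp

lemma power: "x \<in> P \<Longrightarrow> x ^ n \<in> P"
  by (induction n) (auto intro: one mult)

lemma unit_iff: "u \<in> P - max_ideal P \<longleftrightarrow> u \<in> P \<and> u \<noteq> 0 \<and> inverse u \<in> P"
  by (auto simp: max_ideal_def)

lemma one_unit: "1 \<in> P - max_ideal P"
  unfolding unit_iff by (simp add: one)

lemma unit_mult: "u \<in> P - max_ideal P \<Longrightarrow> w \<in> P - max_ideal P \<Longrightarrow> u * w \<in> P - max_ideal P"
  unfolding unit_iff by (simp add: mult)

lemma unit_inverse: "u \<in> P - max_ideal P \<Longrightarrow> inverse u \<in> P - max_ideal P"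
  unfolding unit_iff by simp

lemma unit_power_int:
  assumes "u \<in> P - max_ideal P"
  shows "u powi n \<in> P - max_ideal P"
proof -
  have "u ^ k \<in> P - max_ideal P" for k
  proof (induction k)
    case (Suc k)
    then show ?case using unit_mult[OF assms] by simp
  qed (use one_unit in simp)
  then show ?thesis
    using unit_inverse by (metis power_int_def power_inverse)
qed

lemma uniformizer_not_unit: "uniformizer P t \<Longrightarrow> t \<in> max_ideal P"
  unfolding uniformizer_def using one by force

lemma uniformizer_mem: "uniformizer P t \<Longrightarrow> t \<in> P"
  using uniformizer_not_unit by (simp add: max_ideal_def)

lemma uniformizer_unit_mult:
  assumes t: "uniformizer P t" and u: "u \<in> P - max_ideal P"
  shows "uniformizer P (t * u)"
proof -
  have "{t * u * x | x. x \<in> P} = {t * x | x. x \<in> P}"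
  proof (intro subset_antisym subsetI)
    fix y assume "y \<in> {t * u * x | x. x \<in> P}"
    then show "y \<in> {t * x | x. x \<in> P}" using u mult by (force simp: mult.assoc)
  next
    fix y assume "y \<in> {t * x | x. x \<in> P}"
    then obtain x where "y = t * x" "x \<in> P" by blast
    then have "y = t * u * (inverse u * x)" "inverse u * x \<in> P"
      using u mult unfolding unit_iff by auto
    then show "y \<in> {t * u * x | x. x \<in> P}" by blast
  qed
  then show ?thesis using t u unfolding unit_iff by (simp add: uniformizer_def)
qed

lemma uniformizer_associated:
  assumes t: "uniformizer P t" and t': "uniformizer P t'"
  obtains u where "u \<in> P - max_ideal P" "t' = t * u"
proof -
  obtain x where x: "t' = t * x" "x \<in> P"
    using uniformizer_not_unit[OF t'] t unfolding uniformizer_def by blast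
  obtain y where y: "t = t' * y" "y \<in> P"
    using uniformizer_not_unit[OF t] t' unfolding uniformizer_def by blast
  have "t * (x * y) = t" using x(1) y(1) by (metis mult.assoc)
  then have "x * y = 1" using t by (simp add: uniformizer_def)
  then have "inverse x = y" "x \<noteq> 0" by (auto intro: inverse_unique)
  then have "x \<in> P - max_ideal P" using x y unfolding unit_iff by simp
  with x that show ?thesis by blast
qed

end

text \<open>Exponents in \<open>decomposition\<close> may be negative and \<open>x\<close> is any
  nonzero element of the type, so the whole field is the fraction field of \<open>P\<close>.\<close>

locale dvr = field_subring P for P :: "'a::field set" +
  fixes t :: 'a
  assumes uniformizer: "uniformizer P t"
    and decomposition: "x \<noteq> 0 \<Longrightarrow> \<exists>n u. u \<in> P - max_ideal P \<and> x = t powi n * u"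
begin

lemma t_nonzero: "t \<noteq> 0"
  using uniformizer by (simp add: uniformizer_def)

lemma max_ideal_iff: "x \<in> max_ideal P \<longleftrightarrow> (\<exists>y\<in>P. x = t * y)"
  using uniformizer by (auto simp: uniformizer_def)

lemma max_ideal_subset: "max_ideal P \<subseteq> P"
  by (auto simp: max_ideal_def)

lemma max_ideal_add: "x \<in> max_ideal P \<Longrightarrow> y \<in> max_ideal P \<Longrightarrow> x + y \<in> max_ideal P"
  unfolding max_ideal_iff by (metis add distrib_left)

lemma max_ideal_mult: "x \<in> P \<Longrightarrow> y \<in> max_ideal P \<Longrightarrow> x * y \<in> max_ideal P"
  unfolding max_ideal_iff by (metis mult mult.left_commute)

lemma one_not_max_ideal: "1 \<notin> max_ideal P"
  using one_unit by blast

lemma max_ideal_prime: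
  "x \<in> P \<Longrightarrow> y \<in> P \<Longrightarrow> x * y \<in> max_ideal P \<Longrightarrow> x \<in> max_ideal P \<or> y \<in> max_ideal P"
  using unit_mult[of x y] by blast

lemma power_int_nonneg_mem: "n \<ge> 0 \<Longrightarrow> t powi n \<in> P"
  using uniformizer_mem[OF uniformizer] power by (auto simp: power_int_def)

lemma power_int_pos_mem:
  assumes "n > 0"
  shows "t powi n \<in> max_ideal P"
proof -
  have "t powi n = t powi (n - 1) * t"
    using t_nonzero power_int_add_1[of t "n - 1"] by simp
  then show ?thesis
    using assms max_ideal_mult uniformizer_not_unit[OF uniformizer] power_int_nonneg_mem[of "n - 1"]
    by simp
qed

lemma not_mem_inverse:
  assumes "x \<notin> P"
  shows "inverse x \<in> max_ideal P"
proof -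
  have "x \<noteq> 0" using assms zero by blast
  then obtain n u where u: "u \<in> P - max_ideal P" and x: "x = t powi n * u"
    using decomposition by blast
  have "n < 0" using assms x u mult power_int_nonneg_mem by (metis DiffD1 linorder_not_less)
  have "inverse x = inverse u * t powi (- n)"
    by (simp add: x power_int_minus)
  then show ?thesis
    using max_ideal_mult[OF _ power_int_pos_mem[of "- n"]] unit_inverse[OF u] \<open>n < 0\<close> by simp
qed

text \<open>If \<open>m\<close> exceeded \<open>n\<close>, the unit \<open>u\<close> would be a
  multiple of \<open>t\<close>. Allowing any \<open>y\<close> in \<open>P\<close> serves both the
  uniqueness of orders and the maximality in \<open>form_ord\<close>.\<close>

lemma power_int_le:
  assumes u: "u \<in> P - max_ideal P" and y: "y \<in> P" and eq: "t powi n * u = t powi m * y"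
  shows "m \<le> n"
proof (rule ccontr)
  assume "\<not> m \<le> n"
  have "t powi m = t powi n * t powi (m - n)"
    using t_nonzero by (simp flip: power_int_add)
  then have "u = y * t powi (m - n)" using eq t_nonzero by simp
  then show False
    using u y max_ideal_mult power_int_pos_mem[of "m - n"] \<open>\<not> m \<le> n\<close> by simp
qed

text \<open>Both \<open>ord_at\<close> and \<open>form_ord\<close> quantify over all uniformizers.
  Two of them differ by a unit, which is absorbed into the unit part.\<close>

lemma change_uniformizer:
  assumes "uniformizer P t'"
  shows "dvr P t'"
proof
  show "uniformizer P t'" by fact
  obtain e where e: "e \<in> P - max_ideal P" "t' = t * e"
    using uniformizer_associated[OF uniformizer assms] by blast
  then have e0: "e \<noteq> 0" using unit_iff by blast
  fix x :: 'a assume "x \<noteq> 0"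
  then obtain n u where u: "u \<in> P - max_ideal P" "x = t powi n * u"
    using decomposition by blast
  have "x = t' powi n * (inverse e powi n * u)"
    using e0 by (simp add: u e power_int_mult_distrib power_int_inverse)
  moreover have "inverse e powi n * u \<in> P - max_ideal P"
    using unit_mult unit_power_int unit_inverse e(1) u(1) by blast
  ultimately show "\<exists>n u. u \<in> P - max_ideal P \<and> x = t' powi n * u" by blast
qed

lemma ord_at_eq:
  assumes u: "u \<in> P - max_ideal P" and x: "x = t powi n * u"
  shows "ord_at P x = n"
  unfolding ord_at_def
proof (rule the_equality)
  show "\<exists>t u. uniformizer P t \<and> u \<in> P - max_ideal P \<and> x = t powi n * u"
    using assms uniformizer by blast
next
  fix m assume "\<exists>t u. uniformizer P t \<and> u \<in> P - max_ideal P \<and> x = t powi m * u"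
  then obtain t' w where t': "uniformizer P t'" and w: "w \<in> P - max_ideal P" "x = t' powi m * w"
    by blast
  obtain e where e: "e \<in> P - max_ideal P" "t' = t * e"
    using uniformizer_associated[OF uniformizer t'] by blast
  have "x = t powi m * (e powi m * w)" by (simp add: w e power_int_mult_distrib)
  moreover have "e powi m * w \<in> P - max_ideal P"
    using unit_mult unit_power_int e(1) w(1) by blast
  ultimately show "m = n"
    using x u power_int_le by (metis DiffD1 order_antisym)
qed

lemma ord_at_decomposition:
  assumes "x \<noteq> 0"
  obtains u where "u \<in> P - max_ideal P" "x = t powi ord_at P x * u"
  using decomposition[OF assms] ord_at_eq by metis

text \<open>The witness has minimal order. The induction keeps it or replaces it by the new element,
  according to which of the two quotients lies in \<open>P\<close>.\<close>

lemma finite_common_denominator: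
  assumes "finite X" and "\<exists>x\<in>X. x \<noteq> 0"
  shows "\<exists>c\<in>X. c \<noteq> 0 \<and> (\<forall>x\<in>X. x / c \<in> P)"
  using assms
proof (induction X)
  case (insert x X)
  show ?case
  proof (cases "\<exists>x\<in>X. x \<noteq> 0")
    case False
    then have "x \<noteq> 0" "\<forall>y\<in>X. y = 0" using insert.prems by auto
    then show ?thesis using zero one by auto
  next
    case True
    then obtain c where c: "c \<in> X" "c \<noteq> 0" "\<forall>x\<in>X. x / c \<in> P" using insert.IH by blast
    show ?thesis
    proof (cases "x / c \<in> P")
      case True
      then show ?thesis using c by blast
    next
      case False
      then have x: "x \<noteq> 0" "c / x \<in> P"
        using zero not_mem_inverse[of "x / c"] max_ideal_subset by auto
      have "y / x \<in> P" if "y \<in> X" for y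
        using mult[of "y / c" "c / x"] c that x by simp
      then show ?thesis using x one by auto
    qed
  qed
qed simp

end

section \<open>Regular local rings of dimension one\<close>

lemma krull_dim_quot_unique:
  assumes "krull_dim_quot R p d" and "krull_dim_quot R p e"
  shows "d = e"
  using assms unfolding krull_dim_quot_def by (meson order_antisym)

lemma lspan_singleton:
  assumes "field_subring R"
  shows "lspan (*) R {g} = {g * x | x. x \<in> R}"
proof -
  interpret field_subring R by fact
  have "\<exists>x\<in>R. y = g * x" if "y \<in> lspan (*) R {g}" for y
    using that
  proof induction
    case zero
    show ?case using field_subring.zero[OF assms] by (auto intro: bexI[of _ 0])
  next
    case (step a h u)
    then obtain x where "x \<in> R" "u = g * x" by blast
    then have "u + a * h = g * (x + a)" "x + a \<in> R"
      using step by (auto simp: algebra_simps intro: add)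
    then show ?case by blast
  qed
  moreover have "g * x \<in> lspan (*) R {g}" if "x \<in> R" for x
    using lspan.step[of x R g "{g}" 0 "(*)", OF that] by (simp add: lspan.zero mult.commute)
  ultimately show ?thesis by blast
qed

text \<open>
  Nonzero elements have a finite order because the intersection of the powers of the maximal ideal
  is a prime ideal, which a longer chain of primes would contain if it were nonzero.
\<close>

lemma regular_dim_one_dvr:
  assumes sub: "field_subring P" and frac: "\<And>x. \<exists>a\<in>P. \<exists>b\<in>P. b \<noteq> 0 \<and> x = a / b"
    and reg: "regular_local_quot P {0}" and dim: "krull_dim_quot P {0} 1"
  shows "\<exists>t. dvr P t"
proof -
  interpret field_subring P by fact
  obtain d G where G: "krull_dim_quot P {0} d" "finite G" "card G = d"
      "max_ideal P = {x + y | x y. x \<in> {0} \<and> y \<in> lspan (*) P G}"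
    using reg unfolding regular_local_quot_def by blast
  then have "card G = 1" using krull_dim_quot_unique[OF _ dim] by blast
  then obtain t where "G = {t}" by (auto simp: card_1_singleton_iff)
  then have m: "max_ideal P = {t * x | x. x \<in> P}"
    using G(4) lspan_singleton[OF sub, of t] by auto
  \<comment> \<open>With \<open>t = 0\<close> the maximal ideal would be zero, but the larger prime
    in a chain of length 1 contains a nonzero nonunit.\<close>
  have "t \<noteq> 0"
  proof
    assume "t = 0"
    then have m0: "max_ideal P \<subseteq> {0}" using m by auto
    obtain c where "prime_chain P {0} 1 c" using dim unfolding krull_dim_quot_def by blast
    then have c: "prime_ideal P (c 0)" "prime_ideal P (c 1)" "c 0 \<subset> c 1"
      by (auto simp: prime_chain_def)
    then obtain x where x: "x \<in> c 1" "x \<notin> c 0" by blast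
    have "x \<noteq> 0" using x c(1) unfolding prime_ideal_def by blast
    have "inverse x \<notin> P"
    proof
      assume "inverse x \<in> P"
      then have "inverse x * x \<in> c 1" using c(2) x(1) unfolding prime_ideal_def by blast
      then show False using c(2) \<open>x \<noteq> 0\<close> by (simp add: prime_ideal_def)
    qed
    then have "x \<in> max_ideal P" using c(2) x(1) by (auto simp: max_ideal_def prime_ideal_def)
    then show False using m0 \<open>x \<noteq> 0\<close> by blast
  qed
  then have unif: "uniformizer P t" using m by (simp add: uniformizer_def)
  have tP: "t \<in> P" using uniformizer_mem[OF unif] .
  \<comment> \<open>The elements of infinite order, to be shown to form a prime ideal.\<close>
  define q where "q = {x \<in> P. \<forall>n. \<exists>y\<in>P. x = t ^ n * y}"
  have fin: "\<exists>n u. u \<in> P - max_ideal P \<and> x = t ^ n * u" if x: "x \<in> P" "x \<notin> q" for x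
  proof -
    obtain n where n: "\<nexists>y. y \<in> P \<and> x = t ^ n * y" using x unfolding q_def by blast
    \<comment> \<open>The first power of \<open>t\<close> that does not divide \<open>x\<close>; the
      exponent before it is the order of \<open>x\<close>.\<close>
    define k where "k = (LEAST n. \<nexists>y. y \<in> P \<and> x = t ^ n * y)"
    have k: "\<nexists>y. y \<in> P \<and> x = t ^ k * y" unfolding k_def using n by (rule LeastI)
    then have "k \<noteq> 0" using x by (metis mult_1 power_0)
    then obtain j where j: "k = Suc j" using not0_implies_Suc by blast
    then obtain y where y: "y \<in> P" "x = t ^ j * y"
      using not_less_Least[of j "\<lambda>n. \<nexists>y. y \<in> P \<and> x = t ^ n * y"] unfolding k_def by auto
    have "y \<notin> max_ideal P"
    proof
      assume "y \<in> max_ideal P"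
      then obtain z where "z \<in> P" "y = t * z" using m by blast
      then have "x = t ^ k * z" using y j by simp
      then show False using k \<open>z \<in> P\<close> by blast
    qed
    then show ?thesis using y by blast
  qed
  have not_q: "t ^ n * u \<notin> q" if u: "u \<in> P - max_ideal P" for n u
  proof
    assume "t ^ n * u \<in> q"
    then obtain y where y: "y \<in> P" "t ^ n * u = t ^ Suc n * y" unfolding q_def by blast
    then have "u = t * y" using \<open>t \<noteq> 0\<close> by simp
    then show False using u y m by blast
  qed
  have max_prime: "prime_ideal P (max_ideal P)"
    unfolding prime_ideal_def
  proof (intro conjI ballI impI)
    fix x y
    show "x + y \<in> max_ideal P" if "x \<in> max_ideal P" "y \<in> max_ideal P"
      using that m add by (smt (verit) distrib_left mem_Collect_eq)
    show "x * y \<in> max_ideal P" if "x \<in> P" "y \<in> max_ideal P"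
      using that m mult by (smt (verit) mult.left_commute mem_Collect_eq)
    show "x \<in> max_ideal P \<or> y \<in> max_ideal P" if "x \<in> P" "y \<in> P" "x * y \<in> max_ideal P"
      using unit_mult[of x y] that by blast
  qed (auto simp: max_ideal_def zero)
  have zero_prime: "prime_ideal P {0}"
    by (auto simp: prime_ideal_def zero)
  have q_prime: "prime_ideal P q"
    unfolding prime_ideal_def
  proof (intro conjI ballI impI)
    show "0 \<in> q" using zero by (auto simp: q_def)
    show "1 \<notin> q" using not_q[OF one_unit, of 0] by simp
    fix x y
    show "x + y \<in> q" if "x \<in> q" "y \<in> q"
      unfolding q_def
    proof (intro CollectI conjI allI)
      show "x + y \<in> P" using that add by (simp add: q_def)
      fix n
      obtain x' where "x' \<in> P" "x = t ^ n * x'" using \<open>x \<in> q\<close> unfolding q_def by blast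
      moreover obtain y' where "y' \<in> P" "y = t ^ n * y'" using \<open>y \<in> q\<close> unfolding q_def by blast
      ultimately have "x + y = t ^ n * (x' + y')" "x' + y' \<in> P" by (auto simp: algebra_simps add)
      then show "\<exists>z\<in>P. x + y = t ^ n * z" by blast
    qed
    show "x * y \<in> q" if "x \<in> P" "y \<in> q"
      unfolding q_def
    proof (intro CollectI conjI allI)
      show "x * y \<in> P" using that mult by (simp add: q_def)
      fix n
      obtain y' where "y' \<in> P" "y = t ^ n * y'" using \<open>y \<in> q\<close> unfolding q_def by blast
      then have "x * y = t ^ n * (x * y')" "x * y' \<in> P" using that by (auto simp: mult)
      then show "\<exists>z\<in>P. x * y = t ^ n * z" by blast
    qed
    show "x \<in> q \<or> y \<in> q" if xy: "x \<in> P" "y \<in> P" "x * y \<in> q"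
    proof (rule ccontr)
      assume "\<not> (x \<in> q \<or> y \<in> q)"
      then obtain n u k w where "u \<in> P - max_ideal P" "x = t ^ n * u"
          "w \<in> P - max_ideal P" "y = t ^ k * w"
        using fin xy by metis
      then have "x * y = t ^ (n + k) * (u * w)" "u * w \<in> P - max_ideal P"
        using unit_mult by (auto simp: power_add)
      then show False using not_q xy by metis
    qed
  qed (auto simp: q_def)
  \<comment> \<open>Otherwise zero, \<open>q\<close> and the maximal ideal form a chain of primes of
    length 2.\<close>
  have "q = {0}"
  proof (rule ccontr)
    assume "q \<noteq> {0}"
    then have "{0} \<subset> q" using q_prime unfolding prime_ideal_def by blast
    moreover have "q \<subset> max_ideal P"
    proof
      have "x = t * y \<Longrightarrow> y \<in> P \<Longrightarrow> x \<in> max_ideal P" for x y using m by blast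
      then show "q \<subseteq> max_ideal P" unfolding q_def by (force dest: spec[of _ 1])
      have "t \<notin> q" using not_q[OF one_unit, of 1] by simp
      then show "q \<noteq> max_ideal P" using uniformizer_not_unit[OF unif] by blast
    qed
    ultimately have "prime_chain P {0} 2 (\<lambda>i. if i = 0 then {0} else if i = 1 then q else max_ideal P)"
      using zero_prime q_prime max_prime by (auto simp: prime_chain_def less_2_cases_iff)
    then show False using dim unfolding krull_dim_quot_def by fastforce
  qed
  have "dvr P t"
  proof
    show "uniformizer P t" by fact
    fix x :: 'a assume "x \<noteq> 0"
    obtain a b where ab: "a \<in> P" "b \<in> P" "b \<noteq> 0" "x = a / b" using frac by blast
    then have "a \<notin> q" "b \<notin> q" using \<open>x \<noteq> 0\<close> \<open>q = {0}\<close> by auto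
    then obtain n u k w where uw: "u \<in> P - max_ideal P" "a = t ^ n * u"
        "w \<in> P - max_ideal P" "b = t ^ k * w"
      using fin ab by metis
    have "x = t powi (int n - int k) * (u * inverse w)"
      using \<open>t \<noteq> 0\<close> by (simp add: ab uw power_int_diff field_simps)
    moreover have "u * inverse w \<in> P - max_ideal P" using unit_mult unit_inverse uw by blast
    ultimately show "\<exists>n u. u \<in> P - max_ideal P \<and> x = t powi n * u" by blast
  qed
  then show ?thesis ..
qed

section \<open>Derivations preserving a discrete valuation ring\<close>

lemma derivation_scale:
  "derivation \<iota> D \<Longrightarrow> derivation \<iota> (\<lambda>x. e * D x)"
  by (auto simp: derivation_def algebra_simps)

lemma derivation_diff:
  assumes "derivation \<iota> D"
  shows "D (x - y) = D x - D y"
proof -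
  have "D (x - y + y) = D (x - y) + D y" using assms unfolding derivation_def by blast
  then show ?thesis by simp
qed

lemma alg_gen_subring:
  assumes "field_embedding \<iota>"
  shows "field_subring (alg_gen \<iota> X)"
proof
  have i: "\<iota> (x + y) = \<iota> x + \<iota> y" "\<iota> 1 = 1" for x y
    using assms by (auto simp: field_embedding_def)
  have i0: "\<iota> 0 = 0" using field_embedding_hom_on[OF assms] by (simp add: hom_on_def)
  show "0 \<in> alg_gen \<iota> X" "1 \<in> alg_gen \<iota> X"
    using alg_gen.scalar[of \<iota> _ X] i0 i(2) by metis+
  have "\<iota> (- 1) + 1 = 0" using i(1)[of "- 1" 1] i(2) i0 by simp
  then have "\<iota> (- 1) = - 1" by (simp add: eq_neg_iff_add_eq_0)
  then show "- x \<in> alg_gen \<iota> X" if "x \<in> alg_gen \<iota> X" for x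
    using alg_gen.mult[OF alg_gen.scalar that, of "- 1"] by simp
qed (auto intro: alg_gen.intros)

section \<open>Localization at a prime ideal\<close>

context field_subring
begin

lemma localization_subring:
  assumes p: "prime_ideal P p"
  shows "field_subring (localization P p)"
proof -
  have p': "0 \<in> p" "1 \<notin> p" "\<And>x y. x \<in> P \<Longrightarrow> y \<in> P \<Longrightarrow> x * y \<in> p \<Longrightarrow> x \<in> p \<or> y \<in> p"
    using p unfolding prime_ideal_def by blast+
  have I: "x / y \<in> localization P p" if "x \<in> P" "y \<in> P" "y \<notin> p" for x y
    using that unfolding localization_def by blast
  show ?thesis
  proof
    show "0 \<in> localization P p" "1 \<in> localization P p"
      using I[of _ 1] zero one p' by fastforce+
    fix x assume "x \<in> localization P p"
    then obtain a b where a: "a \<in> P" "b \<in> P" "b \<notin> p" "x = a / b" unfolding localization_def by blast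
    show "- x \<in> localization P p" using I[of "- a" b] a uminus by simp
    fix y assume "y \<in> localization P p"
    then obtain c d where c: "c \<in> P" "d \<in> P" "d \<notin> p" "y = c / d" unfolding localization_def by blast
    have "b \<noteq> 0" "d \<noteq> 0" using a c p' by auto
    then have "x + y = (a * d + c * b) / (b * d)" "x * y = (a * c) / (b * d)"
      by (auto simp: a c field_simps)
    moreover have "b * d \<in> P" "b * d \<notin> p" using a c p' mult by blast+
    ultimately show "x + y \<in> localization P p" "x * y \<in> localization P p"
      using I a c by (auto simp: mult add)
  qed
qed

lemma localization_subset:
  assumes "prime_ideal P p"
  shows "P \<subseteq> localization P p"
proof
  fix x assume "x \<in> P"
  then show "x \<in> localization P p"
    unfolding localization_def mem_Collect_eq
    by (intro exI[of _ x] exI[of _ 1]) (use assms one in \<open>auto simp: prime_ideal_def\<close>)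
qed

lemma localization_inverse:
  assumes "y \<in> P" and "y \<notin> p"
  shows "inverse y \<in> localization P p"
proof -
  have "inverse y = 1 / y" by (simp add: divide_inverse)
  then show ?thesis unfolding localization_def using assms one by blast
qed

end

context dvr
begin

text \<open>Finite generation bounds the poles of \<open>D\<close>: a value \<open>D x\<close> of
  minimal order on the generators divides the others, and the Leibniz rule carries this to the
  algebra and its localization. Dividing \<open>D\<close> by \<open>D x\<close> then preserves
  \<open>P\<close>.\<close>

lemma derivation_bound:
  assumes emb: "field_embedding \<iota>" and two: "(2 :: 'a) = 0" and X: "finite X"
    and p: "prime_ideal (alg_gen \<iota> X) p" and P: "P = localization (alg_gen \<iota> X) p"
    and frac: "\<And>x. \<exists>a\<in>alg_gen \<iota> X. \<exists>b\<in>alg_gen \<iota> X. b \<noteq> 0 \<and> x = a / b"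
    and D: "derivation \<iota> D" and ne: "D z \<noteq> 0"
  shows "\<exists>x\<in>P. D x \<noteq> 0 \<and> (\<forall>y\<in>P. D y / D x \<in> P)"
proof -
  interpret A: field_subring "alg_gen \<iota> X" by (rule alg_gen_subring) fact
  note D' = D[unfolded derivation_def]
  note mult_P = mult
  have AP: "alg_gen \<iota> X \<subseteq> P" using A.localization_subset[OF p] P by simp
  \<comment> \<open>A derivation that kills the generators kills the algebra and hence its fraction
    field, against \<open>ne\<close>.\<close>
  have "\<exists>x\<in>X. D x \<noteq> 0"
  proof (rule ccontr)
    assume *: "\<not> (\<exists>x\<in>X. D x \<noteq> 0)"
    have D0: "D x = 0" if "x \<in> alg_gen \<iota> X" for x
      using that by induction (use D' * in auto)
    obtain a b where ab: "a \<in> alg_gen \<iota> X" "b \<in> alg_gen \<iota> X" "b \<noteq> 0" "z = a / b"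
      using frac by metis
    have "D (b * z) = b * D z + z * D b" using D' by blast
    then show False using ab D0 ne by simp
  qed
  then obtain c where c: "c \<in> D ` X" "c \<noteq> 0" "\<And>x. x \<in> X \<Longrightarrow> D x / c \<in> P"
    using finite_common_denominator[of "D ` X"] X by auto
  then obtain x where x: "x \<in> X" "D x = c" by blast
  have DA: "D y / c \<in> P" if "y \<in> alg_gen \<iota> X" for y
    using that
  proof induction
    case (mult y z)
    have "D (y * z) / c = y * (D z / c) + z * (D y / c)"
      using D' by (simp add: add_divide_distrib)
    moreover have "y \<in> P" "z \<in> P" using mult AP by blast+
    ultimately show ?case using mult.IH add mult_P by metis
  qed (use D' c zero in \<open>auto simp: add_divide_distrib intro: add\<close>)
  have "D y / c \<in> P" if y: "y \<in> P" for y
  proof -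
    obtain a b where ab: "a \<in> alg_gen \<iota> X" "b \<in> alg_gen \<iota> X" "b \<notin> p" "y = a / b"
      using y unfolding P localization_def by blast
    have "b \<noteq> 0" using ab p unfolding prime_ideal_def by blast
    have ib: "inverse b \<in> P" using A.localization_inverse ab P by blast
    \<comment> \<open>The denominator is made a square, which \<open>D\<close> treats as a
      constant.\<close>
    have "y = (inverse b)\<^sup>2 * (a * b)"
      using \<open>b \<noteq> 0\<close> by (simp add: ab power2_eq_square field_simps)
    moreover have "D ((inverse b)\<^sup>2 * (a * b)) = (inverse b)\<^sup>2 * D (a * b) + a * b * D ((inverse b)\<^sup>2)"
      using D' by blast
    ultimately have "D y / c = (inverse b)\<^sup>2 * (D (a * b) / c)"
      by (simp add: derivation_square[OF two D])
    then show ?thesis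
      using mult[OF power[OF ib] DA[OF alg_gen.mult[OF ab(1,2)]]] by metis
  qed
  moreover have "x \<in> P" using x AP alg_gen.gen by blast
  ultimately show ?thesis using x(2) c(2) by blast
qed

section \<open>Integral bases over the subring of squares\<close>

context
  assumes two: "(2 :: 'a) = 0"
begin

text \<open>If \<open>b\<close> were a unit, \<open>x\<close> would be congruent to the square of
  \<open>a / b\<close>. So 1 and the class of \<open>x\<close> are independent over the squares of
  the residue field.\<close>

lemma residue_nonsquare:
  assumes x: "x \<in> P" "\<forall>s\<in>P. x - s\<^sup>2 \<notin> max_ideal P"
    and ab: "a \<in> P" "b \<in> P" "a\<^sup>2 + b\<^sup>2 * x \<in> max_ideal P"
  shows "a \<in> max_ideal P \<and> b \<in> max_ideal P"
proof -
  have b: "b \<in> max_ideal P"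
  proof (rule ccontr)
    assume "b \<notin> max_ideal P"
    then have u: "b \<noteq> 0" "inverse b \<in> P" using ab(2) unit_iff by blast+
    have "(inverse b)\<^sup>2 * (a\<^sup>2 + b\<^sup>2 * x) = x - (inverse b * a)\<^sup>2"
      using u by (simp add: diff_eq_add[OF two] power_mult_distrib field_simps)
    moreover have "(inverse b)\<^sup>2 * (a\<^sup>2 + b\<^sup>2 * x) \<in> max_ideal P"
      using ab u power max_ideal_mult by blast
    moreover have "inverse b * a \<in> P" using u ab mult by blast
    ultimately show False using x(2) by auto
  qed
  have "b\<^sup>2 * x = (b * x) * b" by (simp add: power2_eq_square)
  then have "b\<^sup>2 * x \<in> max_ideal P" using b ab x mult max_ideal_mult by metis
  then have "a\<^sup>2 + b\<^sup>2 * x + b\<^sup>2 * x \<in> max_ideal P" using ab max_ideal_add by blast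
  then have "a * a \<in> max_ideal P" by (simp add: add.assoc double_zero[OF two] power2_eq_square)
  then show ?thesis using b ab max_ideal_prime by blast
qed

text \<open>Reduction modulo \<open>t\<close> forces \<open>a\<close> and \<open>b\<close> into the
  maximal ideal; their squares are then divisible by \<open>t\<^sup>2\<close>, and dividing the
  relation by \<open>t\<close> does the same for \<open>c\<close> and \<open>d\<close>.\<close>

lemma sq_comb_max_ideal:
  assumes x: "x \<in> P" "\<forall>s\<in>P. x - s\<^sup>2 \<notin> max_ideal P"
    and P: "a \<in> P" "b \<in> P" "c \<in> P" "d \<in> P" "y \<in> P" and eq: "sq_comb x t a b c d = t\<^sup>2 * y"
  shows "a \<in> max_ideal P \<and> b \<in> max_ideal P \<and> c \<in> max_ideal P \<and> d \<in> max_ideal P"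
proof -
  have "a\<^sup>2 + b\<^sup>2 * x = t * (t * y - (c\<^sup>2 + d\<^sup>2 * x))"
    using eq by (simp add: sq_comb_def power2_eq_square algebra_simps)
  moreover have "t * y - (c\<^sup>2 + d\<^sup>2 * x) \<in> P"
    using P x uniformizer_mem[OF uniformizer] by (intro diff add mult power) auto
  ultimately have "a\<^sup>2 + b\<^sup>2 * x \<in> max_ideal P" unfolding max_ideal_iff by blast
  then have ab: "a \<in> max_ideal P" "b \<in> max_ideal P" using residue_nonsquare x P by blast+
  then obtain a' b' where a': "a = t * a'" "a' \<in> P" and b': "b = t * b'" "b' \<in> P"
    unfolding max_ideal_iff by blast
  have "t * (c\<^sup>2 + d\<^sup>2 * x) = t * (t * (y - a'\<^sup>2 - b'\<^sup>2 * x))"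
    using eq by (simp add: sq_comb_def power2_eq_square algebra_simps a' b')
  then have "c\<^sup>2 + d\<^sup>2 * x = t * (y - a'\<^sup>2 - b'\<^sup>2 * x)"
    using t_nonzero by (metis mult_cancel_left)
  moreover have "y - a'\<^sup>2 - b'\<^sup>2 * x \<in> P"
    using P x a' b' by (intro diff mult power) auto
  ultimately have "c\<^sup>2 + d\<^sup>2 * x \<in> max_ideal P" unfolding max_ideal_iff by blast
  then show ?thesis using residue_nonsquare x P ab by blast
qed

text \<open>Normalize by a coefficient \<open>e\<close> of minimal order. If \<open>e\<close> were
  outside \<open>P\<close>, the rescaled combination would be divisible by \<open>t\<^sup>2\<close>,
  so all rescaled coefficients would be nonunits, although one of them is 1.\<close>

lemma sq_comb_integral:
  assumes x: "x \<in> P" "\<forall>s\<in>P. x - s\<^sup>2 \<notin> max_ideal P"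
    and y: "sq_comb x t a b c d \<in> P"
  shows "{a, b, c, d} \<subseteq> P"
proof (rule ccontr)
  assume *: "\<not> {a, b, c, d} \<subseteq> P"
  then have "\<exists>z\<in>{a, b, c, d}. z \<noteq> 0" using zero by auto
  then obtain e where e: "e \<in> {a, b, c, d}" "e \<noteq> 0" "\<And>z. z \<in> {a, b, c, d} \<Longrightarrow> z / e \<in> P"
    using finite_common_denominator[of "{a, b, c, d}"] by blast
  have "e \<notin> P"
  proof
    assume "e \<in> P"
    then have "z \<in> P" if "z \<in> {a, b, c, d}" for z using e(3)[OF that] e(2) mult[of "z / e" e] by simp
    then show False using * by blast
  qed
  then obtain w where w: "w \<in> P" "inverse e = t * w"
    using not_mem_inverse max_ideal_iff by blast
  have "sq_comb x t (inverse e * a) (inverse e * b) (inverse e * c) (inverse e * d) =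
      t\<^sup>2 * (w\<^sup>2 * sq_comb x t a b c d)"
    unfolding sq_comb_scale w(2) by (simp add: power_mult_distrib)
  moreover have "w\<^sup>2 * sq_comb x t a b c d \<in> P" using w y mult power by blast
  moreover have "inverse e * z \<in> P" if "z \<in> {a, b, c, d}" for z
    using e(3)[OF that] by (simp add: divide_inverse mult.commute)
  ultimately have "inverse e * z \<in> max_ideal P" if "z \<in> {a, b, c, d}" for z
    using sq_comb_max_ideal[OF x, of "inverse e * a" "inverse e * b" "inverse e * c" "inverse e * d"] that
    by auto
  then have "inverse e * e \<in> max_ideal P" using e(1) by blast
  then show False using e(2) one_not_max_ideal by simp
qed

text \<open>A nontrivial relation can be rescaled until a coefficient is \<open>inverse t\<close>;
  its value is still 0, so integrality would put \<open>inverse t\<close> into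
  \<open>P\<close>.\<close>

lemma two_independent_residue:
  assumes x: "x \<in> P" "\<forall>s\<in>P. x - s\<^sup>2 \<notin> max_ideal P"
  shows "two_independent x t"
  unfolding two_independent_def
proof (intro allI impI, rule ccontr)
  fix a b c d assume 0: "sq_comb x t a b c d = 0"
  assume "\<not> (a = 0 \<and> b = 0 \<and> c = 0 \<and> d = 0)"
  then obtain e where e: "e \<in> {a, b, c, d}" "e \<noteq> 0" by blast
  let ?r = "inverse (t * e)"
  have "sq_comb x t (?r * a) (?r * b) (?r * c) (?r * d) \<in> P"
    unfolding sq_comb_scale 0 using zero by simp
  then have "{?r * a, ?r * b, ?r * c, ?r * d} \<subseteq> P"
    by (rule sq_comb_integral[OF x])
  then have "?r * e \<in> P" using e(1) by blast
  moreover have "?r * e = inverse t" using e(2) by (simp add: field_simps)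
  ultimately have "inverse t \<in> P" by metis
  then show False
    using uniformizer_not_unit[OF uniformizer] t_nonzero by (simp add: max_ideal_def)
qed

text \<open>\<open>D\<close> and \<open>E\<close> are the partial derivatives in \<open>t\<close>
  and \<open>x\<close> for the 2-basis \<open>x, t\<close>, which spans by the dimension count
  against \<open>r, s\<close>. They preserve \<open>P\<close> because elements of \<open>P\<close>
  have coefficients in \<open>P\<close>.\<close>

lemma derivations_of_residue_basis:
  fixes \<iota> :: "'k::field \<Rightarrow> 'a"
  assumes sq: "\<forall>c. \<exists>e. \<iota> c = e\<^sup>2" and span: "two_spanning r (s :: 'a)"
    and x: "x \<in> P" "\<forall>s\<in>P. x - s\<^sup>2 \<notin> max_ideal P"
  obtains D E where "derivation \<iota> D" "D t = 1" "D ` P \<subseteq> P"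
    and "derivation \<iota> E" "E x = 1" "E ` P \<subseteq> P"
proof -
  note ind = two_independent_residue[OF x]
  note span' = two_independent_spanning[OF two span ind]
  obtain D where D: "derivation \<iota> D" "\<And>a b c d. D (sq_comb x t a b c d) = c\<^sup>2 + d\<^sup>2 * x"
    using two_basis_derivation[OF two ind span' sq] by metis
  obtain E where E: "derivation \<iota> E" "\<And>a b c d. E (sq_comb t x a b c d) = c\<^sup>2 + d\<^sup>2 * t"
    using two_basis_derivation[OF two two_independent_swap[OF ind] two_spanning_swap[OF span'] sq]
    by metis
  have "D y \<in> P \<and> E y \<in> P" if y: "y \<in> P" for y
  proof -
    obtain a b c d where abcd: "y = sq_comb x t a b c d"
      using span' unfolding two_spanning_def by blast
    then have "{a, b, c, d} \<subseteq> P" using sq_comb_integral[OF x] y by blast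
    moreover have "D y = c\<^sup>2 + d\<^sup>2 * x" using D(2) abcd by blast
    moreover have "E y = b\<^sup>2 + d\<^sup>2 * t" using E(2) abcd by (simp only: sq_comb_swap[of x])
    ultimately show ?thesis using x uniformizer_mem[OF uniformizer] by (auto intro!: add mult power)
  qed
  moreover have "D t = 1" using D(2)[of 0 0 1 0] by (simp add: sq_comb_def)
  moreover have "E x = 1" using E(2)[of 0 0 1 0] by (simp add: sq_comb_def)
  ultimately show ?thesis using that[of D E] D E by blast
qed

text \<open>
  This is where the geometry of \<open>P\<close> enters: some derivation, rescaled to preserve \<open>P\<close> without
  vanishing modulo the maximal ideal, either is a unit on \<open>t\<close> or induces a nonzero derivation of the
  residue field, which therefore contains nonsquares.
\<close>

lemma derivation_unit_at_uniformizer: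
  fixes \<iota> :: "'k::field \<Rightarrow> 'a"
  assumes sq: "\<forall>c. \<exists>e. \<iota> c = e\<^sup>2"
    and rs: "two_independent r s" "two_spanning r (s :: 'a)"
    and bound: "\<forall>D. derivation \<iota> D \<and> (\<exists>z. D z \<noteq> 0) \<longrightarrow>
      (\<exists>x\<in>P. D x \<noteq> 0 \<and> (\<forall>y\<in>P. D y / D x \<in> P))"
  obtains D where "derivation \<iota> D" "D t \<in> P - max_ideal P" "D ` P \<subseteq> P"
proof -
  obtain D1 where D1: "derivation \<iota> D1" "\<And>a b c d. D1 (sq_comb r s a b c d) = c\<^sup>2 + d\<^sup>2 * r"
    using two_basis_derivation[OF two rs sq] by metis
  \<comment> \<open>Shows that \<open>D1\<close> is nonzero, as \<open>bound\<close>
    requires.\<close>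
  have "D1 s = 1" using D1(2)[of 0 0 1 0] by (simp add: sq_comb_def)
  then obtain x where x: "x \<in> P" "D1 x \<noteq> 0" "\<And>y. y \<in> P \<Longrightarrow> D1 y / D1 x \<in> P"
    using bound D1(1) by (metis one_neq_zero)
  define D where "D y = inverse (D1 x) * D1 y" for y
  have D: "derivation \<iota> D" unfolding D_def by (rule derivation_scale) (rule D1)
  have DP: "D y \<in> P" if "y \<in> P" for y
    using x(3)[OF that] by (simp add: D_def divide_inverse mult.commute)
  have Dx: "D x = 1" using x by (simp add: D_def)
  show ?thesis
  proof (cases "D t \<in> max_ideal P")
    case False
    then have "D t \<in> P - max_ideal P" using DP uniformizer_mem[OF uniformizer] by blast
    with D DP that show ?thesis by blast
  next
    case True
    \<comment> \<open>Here \<open>D\<close> induces a derivation of the residue field. If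
      \<open>x\<close> were a square there, \<open>1 = D (x - s\<^sup>2) = t * D z + z * D t\<close>
      would lie in the maximal ideal.\<close>
    have "\<forall>s\<in>P. x - s\<^sup>2 \<notin> max_ideal P"
    proof (intro ballI notI)
      fix s assume "s \<in> P"
      assume "x - s\<^sup>2 \<in> max_ideal P"
      then obtain z where z: "z \<in> P" "x - s\<^sup>2 = t * z" unfolding max_ideal_iff by blast
      have "D (t * z) = t * D z + z * D t" using D unfolding derivation_def by blast
      moreover have "D (t * z) = 1"
        unfolding z(2)[symmetric] derivation_diff[OF D] derivation_square[OF two D] Dx by simp
      moreover have "t * D z \<in> max_ideal P" using DP[OF z(1)] max_ideal_iff by blast
      moreover have "z * D t \<in> max_ideal P" using True z max_ideal_mult by blast
      ultimately show False using max_ideal_add one_not_max_ideal by metis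
    qed
    then obtain D' where "derivation \<iota> D'" "D' t = 1" "D' ` P \<subseteq> P"
      using derivations_of_residue_basis[OF sq rs(2) x(1)] by metis
    with that one_unit show ?thesis by metis
  qed
qed

text \<open>The condition on \<open>h\<close> is what normality supplies. Either the residue of
  \<open>h\<close> is a nonsquare and \<open>h\<close> belongs to a 2-basis, or subtracting a square
  leaves a uniformizer, to which the previous lemma applies in place of \<open>t\<close>.\<close>

lemma derivation_unit:
  fixes \<iota> :: "'k::field \<Rightarrow> 'a"
  assumes sq: "\<forall>c. \<exists>e. \<iota> c = e\<^sup>2"
    and rs: "two_independent r s" "two_spanning r (s :: 'a)"
    and bound: "\<forall>D. derivation \<iota> D \<and> (\<exists>z. D z \<noteq> 0) \<longrightarrow>
      (\<exists>x\<in>P. D x \<noteq> 0 \<and> (\<forall>y\<in>P. D y / D x \<in> P))"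
    and h: "h \<in> P" "\<forall>s\<in>P. \<forall>y\<in>P. h \<noteq> s\<^sup>2 + t\<^sup>2 * y"
  obtains D where "derivation \<iota> D" "D h \<in> P - max_ideal P" "D ` P \<subseteq> P"
proof (cases "\<exists>s\<in>P. h - s\<^sup>2 \<in> max_ideal P")
  case False
  then have "\<forall>s\<in>P. h - s\<^sup>2 \<notin> max_ideal P" by blast
  then obtain D where "derivation \<iota> D" "D h = 1" "D ` P \<subseteq> P"
    using derivations_of_residue_basis[OF sq rs(2) h(1)] by metis
  with that one_unit show ?thesis by metis
next
  case True
  then obtain q z where q: "q \<in> P" "h - q\<^sup>2 = t * z" "z \<in> P" unfolding max_ideal_iff by blast
  have "z \<notin> max_ideal P"
  proof
    assume "z \<in> max_ideal P"
    then obtain y where y: "y \<in> P" "z = t * y" unfolding max_ideal_iff by blast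
    then have "h = q\<^sup>2 + t\<^sup>2 * y" using q by (simp add: power2_eq_square algebra_simps)
    then show False using h(2) q y by blast
  qed
  then have "uniformizer P (h - q\<^sup>2)"
    unfolding q(2) using uniformizer_unit_mult[OF uniformizer] q(3) by blast
  then interpret h: dvr P "h - q\<^sup>2" by (rule change_uniformizer)
  obtain D where D: "derivation \<iota> D" "D (h - q\<^sup>2) \<in> P - max_ideal P" "D ` P \<subseteq> P"
    using h.derivation_unit_at_uniformizer[OF two sq rs bound] by blast
  have "D (h - q\<^sup>2) = D h"
    by (simp add: derivation_diff[OF D(1)] derivation_square[OF two D(1)])
  with D that show ?thesis by metis
qed

end

end

section \<open>Evaluating differential forms on derivations\<close>

text \<open>The pairing of a one-form with a derivation, on representatives in the free
  module.\<close>

definition contract :: "('a \<Rightarrow> 'a) \<Rightarrow> ('a \<Rightarrow>\<^sub>0 'a::field) \<Rightarrow> 'a" where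
  "contract D u = (\<Sum>x\<in>Poly_Mapping.keys u. Poly_Mapping.lookup u x * D x)"

lemma lookup_fscale: "Poly_Mapping.lookup (fscale a u) x = a * Poly_Mapping.lookup u x"
  by (simp add: fscale_def Poly_Mapping.map.rep_eq when_def)

lemma fscale_single [simp]: "fscale a (Poly_Mapping.single x b) = Poly_Mapping.single x (a * b)"
  by (rule poly_mapping_eqI) (simp add: lookup_fscale lookup_single when_def)

lemma fscale_add: "fscale a (u + v) = fscale a u + fscale a v"
  by (rule poly_mapping_eqI) (simp add: lookup_fscale lookup_add algebra_simps)

lemma fscale_diff: "fscale a (u - v) = fscale a u - fscale a v"
  by (rule poly_mapping_eqI) (simp add: lookup_fscale lookup_minus algebra_simps)

lemma fscale_fscale: "fscale a (fscale b u) = fscale (a * b) u"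
  by (rule poly_mapping_eqI) (simp add: lookup_fscale)

lemma fscale_zero: "fscale a 0 = 0"
  by (rule poly_mapping_eqI) (simp add: lookup_fscale)

lemma contract_superset:
  assumes "finite X" and "Poly_Mapping.keys u \<subseteq> X"
  shows "contract D u = (\<Sum>x\<in>X. Poly_Mapping.lookup u x * D x)"
  unfolding contract_def using assms
  by (intro sum.mono_neutral_left) (auto simp: in_keys_iff)

lemma contract_add: "contract D (u + v) = contract D u + contract D v"
proof -
  let ?X = "Poly_Mapping.keys u \<union> Poly_Mapping.keys v"
  have "contract D (u + v) = (\<Sum>x\<in>?X. Poly_Mapping.lookup (u + v) x * D x)"
    by (rule contract_superset[OF _ Poly_Mapping.keys_add]) simp
  also have "\<dots> = (\<Sum>x\<in>?X. Poly_Mapping.lookup u x * D x) + (\<Sum>x\<in>?X. Poly_Mapping.lookup v x * D x)"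
    by (simp add: lookup_add distrib_right sum.distrib)
  finally show ?thesis by (simp add: contract_superset[of ?X])
qed

lemma contract_fscale: "contract D (fscale a u) = a * contract D u"
proof -
  have "contract D (fscale a u) = (\<Sum>x\<in>Poly_Mapping.keys u. Poly_Mapping.lookup (fscale a u) x * D x)"
    by (rule contract_superset) (auto simp: in_keys_iff lookup_fscale)
  then show ?thesis
    by (simp add: contract_def lookup_fscale sum_distrib_left mult.assoc)
qed

lemma contract_diff: "contract D (u - v) = contract D u - contract D v"
  using contract_add[of D "u - v" v] by simp

lemma contract_single [simp]: "contract D (Poly_Mapping.single x a) = a * D x"
  by (simp add: contract_def)

lemma contract_zero [simp]: "contract D 0 = 0"
  by (simp add: contract_def)

text \<open>The generating relations are additivity, the Leibniz rule and the vanishing on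
  constants, so the pairing descends to forms.\<close>

lemma contract_form_relations1:
  assumes D: "derivation \<iota> D" and u: "u \<in> form_relations1 \<iota>"
  shows "contract D u = 0"
  using u unfolding form_relations1_def
proof induction
  case (step a g u)
  have "contract D g = 0"
    using step(2) D unfolding derivation_def by (auto simp: contract_diff)
  then show ?case using step by (simp add: contract_add contract_fscale)
qed simp

lemma lspan_fscale_generator: "a \<in> R \<Longrightarrow> g \<in> G \<Longrightarrow> fscale a g \<in> lspan fscale R G"
  using lspan.step[of a R g G 0 fscale] by (simp add: lspan.zero)

lemma lspan_add:
  assumes "u \<in> lspan scale R G" and "v \<in> lspan scale R G"
  shows "u + v \<in> lspan scale R G"
  using assms(2) by induction (use assms(1) in \<open>auto simp: add.assoc[symmetric] intro: lspan.intros\<close>)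

lemma form_relations1_scale:
  assumes "u \<in> form_relations1 \<iota>"
  shows "fscale a u \<in> form_relations1 \<iota>"
  using assms unfolding form_relations1_def
  by induction (auto simp: fscale_zero fscale_add fscale_fscale intro: lspan.zero intro!: lspan.step)

lemma form_relations1_add:
  "u \<in> form_relations1 \<iota> \<Longrightarrow> v \<in> form_relations1 \<iota> \<Longrightarrow> u + v \<in> form_relations1 \<iota>"
  unfolding form_relations1_def by (rule lspan_add)

lemma form_relations1_generators:
  "Poly_Mapping.single (x + y) 1 - Poly_Mapping.single x 1 - Poly_Mapping.single y 1 \<in> form_relations1 \<iota>"
  "Poly_Mapping.single (x * y) 1 - Poly_Mapping.single y x - Poly_Mapping.single x y
     \<in> form_relations1 \<iota>"
proof -
  let ?G = "{Poly_Mapping.single (x + y) 1 - Poly_Mapping.single x 1 - Poly_Mapping.single y 1 | x y. True} \<union>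
      {Poly_Mapping.single (x * y) 1 - Poly_Mapping.single y x - Poly_Mapping.single x y | x y. True} \<union>
      {Poly_Mapping.single (\<iota> c) 1 | c. True}"
  have G: "g \<in> form_relations1 \<iota>" if "g \<in> ?G" for g
  proof -
    have "fscale 1 g = g" by (rule poly_mapping_eqI) (simp add: lookup_fscale)
    then show ?thesis
      using lspan_fscale_generator[OF UNIV_I that, of 1] unfolding form_relations1_def by metis
  qed
  show "Poly_Mapping.single (x + y) 1 - Poly_Mapping.single x 1 - Poly_Mapping.single y 1 \<in> form_relations1 \<iota>"
    by (rule G) blast
  show "Poly_Mapping.single (x * y) 1 - Poly_Mapping.single y x - Poly_Mapping.single x y \<in> form_relations1 \<iota>"
    by (rule G) blast
qed

section \<open>Differentials of squares in characteristic two\<close>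

lemma form_relations1_square:
  assumes two: "(2 :: 'a::field) = 0"
  shows "Poly_Mapping.single (x\<^sup>2) 1 \<in> form_relations1 (\<iota> :: 'k::field \<Rightarrow> 'a)"
proof -
  have "Poly_Mapping.single x x + Poly_Mapping.single x x = 0"
    by (simp only: double_zero[OF two] single_zero flip: single_add)
  then have "Poly_Mapping.single (x * x) 1 - Poly_Mapping.single x x - Poly_Mapping.single x x =
      Poly_Mapping.single (x\<^sup>2) 1"
    by (simp only: diff_diff_eq power2_eq_square diff_zero)
  then show ?thesis using form_relations1_generators(2)[of x x \<iota>] by metis
qed

text \<open>The differentials of \<open>a\<^sup>2\<close> and \<open>b\<^sup>2\<close> vanish, so
  only \<open>a\<^sup>2 dh\<close> survives. The factor \<open>e\<close> will be
  \<open>1 / F\<close>.\<close>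

lemma form_relations1_square_comb:
  assumes two: "(2 :: 'a::field) = 0"
  shows "Poly_Mapping.single h (e * a\<^sup>2) - Poly_Mapping.single (a\<^sup>2 * h + b\<^sup>2) e \<in>
    form_relations1 (\<iota> :: 'k::field \<Rightarrow> 'a)"
proof -
  let ?N = "form_relations1 \<iota>" and ?d = "\<lambda>x::'a. Poly_Mapping.single x (1::'a)"
  have "(?d (a\<^sup>2 * h + b\<^sup>2) - ?d (a\<^sup>2 * h) - ?d (b\<^sup>2))
      + (?d (a\<^sup>2 * h) - Poly_Mapping.single h (a\<^sup>2) - Poly_Mapping.single (a\<^sup>2) h)
      + fscale h (?d (a\<^sup>2)) + ?d (b\<^sup>2) \<in> ?N"
    by (intro form_relations1_add form_relations1_scale form_relations1_square[OF two]
        form_relations1_generators)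
  then have "?d (a\<^sup>2 * h + b\<^sup>2) - Poly_Mapping.single h (a\<^sup>2) \<in> ?N"
    by (simp add: algebra_simps)
  \<comment> \<open>The sign reverses the difference, as membership in \<open>form_class\<close>
    demands.\<close>
  then have "fscale (- e) (?d (a\<^sup>2 * h + b\<^sup>2) - Poly_Mapping.single h (a\<^sup>2)) \<in> ?N"
    by (rule form_relations1_scale)
  then show ?thesis by (simp add: fscale_diff single_uminus)
qed

lemma power_int_double: "(x :: 'a::field) powi (2 * n) = (x powi n)\<^sup>2"
  by (subst mult.commute) (simp add: power_int_mult)

text \<open>The value is attained because the form is \<open>t powi ?n\<close> times a unit times
  \<open>dh\<close>. It is maximal because pairing with \<open>D\<close> sends regular forms into
  \<open>P\<close>, and \<open>dF / F\<close> to an element of order exactly \<open>?n\<close>, as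
  \<open>D h\<close> is a unit.\<close>

lemma (in dvr) form_ord_dlog:
  assumes two: "(2 :: 'a) = 0" and F: "F = a\<^sup>2 * h + b\<^sup>2" "F \<noteq> 0" and a: "a \<noteq> 0" and h: "h \<in> P"
    and D: "derivation \<iota> D" "D h \<in> P - max_ideal P" "D ` P \<subseteq> P"
  shows "form_ord P {Poly_Mapping.single x 1 | x. x \<in> P}
      (form_class (form_relations1 \<iota>) (Poly_Mapping.single F (1 / F))) = 2 * ord_at P a - ord_at P F"
    (is "form_ord P ?G (form_class ?N ?dlog) = ?n")
  unfolding form_ord_def
proof (rule Greatest_equality)
  obtain u where u: "u \<in> P - max_ideal P" "a = t powi ord_at P a * u"
    using ord_at_decomposition[OF a] .
  obtain w where w: "w \<in> P - max_ideal P" "F = t powi ord_at P F * w"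
    using ord_at_decomposition[OF F(2)] .
  define e where "e = u\<^sup>2 * inverse w"
  have e: "e \<in> P - max_ideal P"
    unfolding e_def power2_eq_square by (intro unit_mult unit_inverse u w)
  have "a\<^sup>2 = t powi (2 * ord_at P a) * u\<^sup>2"
    by (subst u(2)) (simp add: power_mult_distrib power_int_double)
  then have "a\<^sup>2 / F = t powi (2 * ord_at P a) * u\<^sup>2 / (t powi ord_at P F * w)"
    by (subst w(2)) simp
  also have "\<dots> = t powi ?n * e"
    using t_nonzero by (simp add: e_def power_int_diff divide_inverse)
  finally have n: "t powi ?n * e = 1 / F * a\<^sup>2" by simp
  have rel: "Poly_Mapping.single h (1 / F * a\<^sup>2) - ?dlog \<in> ?N"
    using form_relations1_square_comb[OF two, of h "1 / F" a b \<iota>] by (simp only: F(1))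
  show "\<exists>t. uniformizer P t \<and> (\<exists>v\<in>lspan fscale P ?G. fscale (t powi ?n) v \<in> form_class ?N ?dlog)"
  proof (intro exI[of _ t] conjI bexI)
    show "uniformizer P t" by (rule uniformizer)
    show "fscale e (Poly_Mapping.single h 1) \<in> lspan fscale P ?G"
      by (rule lspan_fscale_generator) (use e h in auto)
    show "fscale (t powi ?n) (fscale e (Poly_Mapping.single h 1)) \<in> form_class ?N ?dlog"
      using rel by (simp only: form_class_def mem_Collect_eq fscale_single n mult_1_right)
  qed
next
  fix n assume "\<exists>t. uniformizer P t \<and> (\<exists>v\<in>lspan fscale P ?G. fscale (t powi n) v \<in> form_class ?N ?dlog)"
  then obtain t' v where t': "uniformizer P t'" and v: "v \<in> lspan fscale P ?G"
    and "fscale (t' powi n) v \<in> form_class ?N ?dlog" by blast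
  then have "fscale (t' powi n) v - ?dlog \<in> ?N" by (simp add: form_class_def)
  then have "contract D (fscale (t' powi n) v - ?dlog) = 0"
    by (rule contract_form_relations1[OF D(1)])
  then have eq: "t' powi n * contract D v = D F / F"
    by (simp add: contract_diff contract_fscale)
  have "D F = a\<^sup>2 * D h"
    using D(1) derivation_square[OF two D(1)] unfolding F derivation_def by simp
  \<comment> \<open>The competing exponent may come with another uniformizer, so both orders are
    read off with respect to \<open>t'\<close>.\<close>
  interpret t': dvr P t' using t' by (rule change_uniformizer)
  obtain u where u: "u \<in> P - max_ideal P" "a = t' powi ord_at P a * u"
    using t'.ord_at_decomposition[OF a] .
  obtain w where w: "w \<in> P - max_ideal P" "F = t' powi ord_at P F * w"
    using t'.ord_at_decomposition[OF F(2)] .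
  have "a\<^sup>2 = t' powi (2 * ord_at P a) * u\<^sup>2"
    by (subst u(2)) (simp add: power_mult_distrib power_int_double)
  then have "D F / F = t' powi (2 * ord_at P a) * u\<^sup>2 * D h / F"
    by (simp only: \<open>D F = a\<^sup>2 * D h\<close>)
  also have "\<dots> = t' powi (2 * ord_at P a) * u\<^sup>2 * D h / (t' powi ord_at P F * w)"
    using w(2) by metis
  also have "\<dots> = t' powi ?n * (u * u * inverse w * D h)"
    using t'.t_nonzero by (simp add: power_int_diff divide_inverse power2_eq_square)
  finally have "t' powi ?n * (u * u * inverse w * D h) = t' powi n * contract D v"
    using eq by simp
  moreover have "u * u * inverse w * D h \<in> P - max_ideal P"
    by (intro unit_mult unit_inverse u w D)
  moreover have "contract D v \<in> P"
    using v
  proof induction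
    case (step a g u)
    then obtain x where "x \<in> P" "g = Poly_Mapping.single x 1" by blast
    then have "contract D (u + fscale a g) = contract D u + a * D x" "D x \<in> P"
      using D(3) by (auto simp: contract_add)
    then show ?case using step add mult by metis
  qed (simp add: zero)
  ultimately show "n \<le> ?n" using t'.power_int_le by blast
qed

section \<open>The local equation of the normalization\<close>

text \<open>Solving for \<open>w\<close> gives \<open>(z + b) / a\<close> in characteristic two; its
  square modulo \<open>z\<^sup>2 - F\<close> is \<open>(F + b\<^sup>2) / a\<^sup>2\<close>, to be
  compared with \<open>h\<close>.\<close>

lemma normalization_equation:
  fixes F a b h :: "'a::field"
  assumes two: "(2 :: 'a) = 0"
    and h: "[:- F, 0, 1:] dvd w * w - [:h:]" and z: "[:0, 1:] = [:b:] + smult a w"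
  shows "a \<noteq> 0" and "w = [:b / a, 1 / a:]" and "F = a\<^sup>2 * h + b\<^sup>2"
proof -
  have "coeff [:0, 1:] 1 = coeff ([:b:] + smult a w) 1" using z by simp
  then show a: "a \<noteq> 0" by auto
  have "smult a w = [:0, 1:] - [:b:]" using z by simp
  then have "smult (1 / a) (smult a w) = smult (1 / a) [:b, 1:]" using uminus_eq[OF two, of b] by simp
  then show w: "w = [:b / a, 1 / a:]" using a by simp
  \<comment> \<open>The remainder of \<open>w * w - [:h:]\<close> modulo
    \<open>z\<^sup>2 - F\<close>. It is constant, so divisibility forces it to vanish.\<close>
  let ?r = "[:b\<^sup>2 / a\<^sup>2 - h + F / a\<^sup>2:]"
  have "w * w - [:h:] = smult (1 / a\<^sup>2) [:- F, 0, 1:] + ?r"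
    using double_zero[OF two, of "b / (a * a)"] by (simp add: w power2_eq_square algebra_simps)
  then have "[:- F, 0, 1:] dvd ?r"
    using h by (metis dvd_add_right_iff dvd_refl dvd_smult)
  then have "?r = 0" using dvd_imp_degree_le[of "[:- F, 0, 1:]" ?r] by fastforce
  moreover have "b\<^sup>2 / a\<^sup>2 + F / a\<^sup>2 = (b\<^sup>2 / a\<^sup>2 - h + F / a\<^sup>2) + h" by simp
  ultimately have "b\<^sup>2 / a\<^sup>2 + F / a\<^sup>2 = h" by simp
  then have "b\<^sup>2 + F = a\<^sup>2 * h" using a by (simp add: field_simps)
  then have "b\<^sup>2 + F + b\<^sup>2 = a\<^sup>2 * h + b\<^sup>2" by simp
  moreover have "b\<^sup>2 + F + b\<^sup>2 = F + (b\<^sup>2 + b\<^sup>2)" by (simp only: ac_simps)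
  ultimately show "F = a\<^sup>2 * h + b\<^sup>2" by (simp add: double_zero[OF two])
qed

text \<open>
  If \<open>h = s\<^sup>2 + t\<^sup>2 y\<close>, then \<open>(w - s) / t\<close> is integral, being a square root of \<open>y\<close>; clearing
  denominators with \<open>e\<close> gives an integral element over \<open>V\<close> outside \<open>V + V w\<close>.
\<close>

lemma normalization_not_square_mod:
  fixes F a b h :: "'a::field"
  assumes two: "(2 :: 'a) = 0" and sub: "field_subring V" and q: "prime_ideal V q"
    and P: "P = localization V q" and t: "uniformizer P t"
    and norm: "normalization_ring V F = {[:x:] + smult y w | x y. x \<in> V \<and> y \<in> V}"
    and h: "[:- F, 0, 1:] dvd w * w - [:h:]" and z: "[:0, 1:] = [:b:] + smult a w"
    and s: "s \<in> P" and y: "y \<in> P"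
  shows "h \<noteq> s\<^sup>2 + t\<^sup>2 * y"
proof
  assume h': "h = s\<^sup>2 + t\<^sup>2 * y"
  interpret V: field_subring V by fact
  interpret P: field_subring P using V.localization_subring[OF q] P by simp
  note a = normalization_equation(1)[OF two h z] and w = normalization_equation(2)[OF two h z]
  have t0: "t \<noteq> 0" using t by (simp add: uniformizer_def)
  obtain s1 s2 where s12: "s1 \<in> V" "s2 \<in> V" "s2 \<notin> q" "s = s1 / s2"
    using s unfolding P localization_def by blast
  obtain y1 y2 where y12: "y1 \<in> V" "y2 \<in> V" "y2 \<notin> q" "y = y1 / y2"
    using y unfolding P localization_def by blast
  have nz: "s2 \<noteq> 0" "y2 \<noteq> 0" using s12 y12 q unfolding prime_ideal_def by blast+
  \<comment> \<open>A common denominator of \<open>s\<close> and \<open>y\<close>; lying outside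
    \<open>q\<close>, it is invertible in \<open>P\<close>.\<close>
  define e where "e = s2 * y2"
  have e: "e \<in> V" "e \<notin> q" "e \<noteq> 0"
    using s12 y12 q nz V.mult unfolding e_def prime_ideal_def by auto
  have "e\<^sup>2 * y = s2 * s2 * y2 * y1" using nz by (simp add: e_def y12 power2_eq_square)
  then have ey: "e\<^sup>2 * y \<in> V" using s12 y12 V.mult by metis
  define p where "p = smult (e / t) (w - [:s:])"
  have "smult s w + smult s w = 0"
    by (simp add: double_zero[OF two] flip: smult_add_left)
  moreover have "(w - [:s:]) * (w - [:s:]) = w * w - (smult s w + smult s w) + [:s\<^sup>2:]"
    by (simp add: power2_eq_square algebra_simps)
  ultimately have ws: "(w - [:s:]) * (w - [:s:]) = w * w + [:s\<^sup>2:]"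
    by (simp only: diff_zero)
  have "p * p = smult ((e / t)\<^sup>2) (w * w + [:s\<^sup>2:])"
    by (simp only: p_def mult_smult_left mult_smult_right smult_smult power2_eq_square[of "e / t"] ws)
  also have "[:s\<^sup>2:] = [:t\<^sup>2 * y:] - [:h:]"
    using uminus_eq[OF two, of "s\<^sup>2"] by (simp add: h')
  also have "w * w + ([:t\<^sup>2 * y:] - [:h:]) = (w * w - [:h:]) + [:t\<^sup>2 * y:]"
    by (simp only: algebra_simps)
  also have "smult ((e / t)\<^sup>2) ((w * w - [:h:]) + [:t\<^sup>2 * y:]) =
      smult ((e / t)\<^sup>2) (w * w - [:h:]) + [:e\<^sup>2 * y:]"
    unfolding smult_add_right using t0 by (simp add: power_divide)
  finally have pp: "p * p = smult ((e / t)\<^sup>2) (w * w - [:h:]) + [:e\<^sup>2 * y:]" .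
  \<comment> \<open>The monic equation of \<open>p\<close> modulo \<open>z\<^sup>2 - F\<close>; its
    constant term is in \<open>V\<close> by \<open>ey\<close>.\<close>
  let ?Q = "[:[:- (e\<^sup>2 * y):], 0, 1:]"
  have "poly ?Q p = p * p - [:e\<^sup>2 * y:]" by simp
  also have "\<dots> = smult ((e / t)\<^sup>2) (w * w - [:h:])" by (simp only: pp add_diff_cancel_right')
  finally have "[:- F, 0, 1:] dvd poly ?Q p" using h by (simp only: dvd_smult)
  moreover have "\<forall>m. coeff ?Q m \<in> covering_ring V"
    using V.zero V.one V.uminus[OF ey]
    by (auto simp: covering_ring_def coeff_pCons one_pCons split: nat.splits)
  moreover have "degree p < 2" by (simp add: p_def w)
  ultimately have "p \<in> normalization_ring V F"
    unfolding normalization_ring_def by (auto intro!: exI[of _ ?Q])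
  then obtain x' y' where xy: "p = [:x':] + smult y' w" "y' \<in> V" using norm by blast
  \<comment> \<open>Comparing coefficients of \<open>z\<close>, where \<open>w\<close> has
    \<open>1 / a\<close>, puts \<open>e / t\<close> into \<open>V\<close> and so makes
    \<open>t\<close> a unit of \<open>P\<close>.\<close>
  have "coeff p 1 = coeff ([:x':] + smult y' w) 1" using xy by simp
  then have "e / t * (1 / a) = y' * (1 / a)" by (simp add: p_def w)
  then have "e / t = y'" using a by (metis mult_cancel_right divide_eq_0_iff one_neq_zero)
  then have "inverse t = inverse e * y'" using e by (simp add: field_simps)
  moreover have "inverse e \<in> P" using V.localization_inverse e P by blast
  moreover have "y' \<in> P" using V.localization_subset[OF q] xy P by blast
  ultimately have "inverse t \<in> P" using P.mult by metis
  then show False using P.uniformizer_not_unit[OF t] t0 by (simp add: max_ideal_def)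
qed

section \<open>Local rings of a projective variety\<close>

text \<open>The chart \<open>A i\<close> around \<open>P\<close> may differ from the chart
  \<open>A k\<close> containing the generic point \<open>UNIV\<close>, so fractions over
  \<open>A k\<close> are rewritten as fractions over \<open>A i\<close>.\<close>

lemma projective_variety_local_ring:
  assumes emb: "field_embedding \<iota>" and S: "projective_variety \<iota> S" and P: "P \<in> S"
  obtains X p where "finite X" "prime_ideal (alg_gen \<iota> X) p" "P = localization (alg_gen \<iota> X) p"
    "\<And>x. \<exists>a\<in>alg_gen \<iota> X. \<exists>b\<in>alg_gen \<iota> X. b \<noteq> 0 \<and> x = a / b"
proof -
  obtain N :: nat and x where UNIV: "UNIV \<in> S"
    and S': "S = (\<Union>i\<in>{i. i \<le> N \<and> x i \<noteq> 0}. spec (alg_gen \<iota> {x j / x i | j. j \<le> N}))"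
    using S unfolding projective_variety_def by blast
  define A where "A i = alg_gen \<iota> {x j / x i | j. j \<le> N}" for i
  obtain i where i: "i \<le> N" "x i \<noteq> 0" "P \<in> spec (A i)" using P S' unfolding A_def by blast
  obtain k where k: "k \<le> N" "x k \<noteq> 0" "UNIV \<in> spec (A k)" using UNIV S' unfolding A_def by blast
  obtain p where p: "prime_ideal (A i) p" "P = localization (A i) p"
    using i unfolding spec_def by blast
  interpret Ai: field_subring "A i" unfolding A_def by (rule alg_gen_subring) fact
  define Q where "Q = {a / b | a b. a \<in> A i \<and> b \<in> A i \<and> b \<noteq> 0}"
  have QI: "a / b \<in> Q" if "a \<in> A i" "b \<in> A i" "b \<noteq> 0" for a b
    using that unfolding Q_def by blast
  have Qdiv: "z / w \<in> Q" if zw: "z \<in> Q" "w \<in> Q" for z w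
  proof (cases "w = 0")
    case True
    then show ?thesis using QI[OF Ai.zero Ai.one] by simp
  next
    case False
    obtain a b c d where ab: "z = a / b" "a \<in> A i" "b \<in> A i" "b \<noteq> 0"
      "w = c / d" "c \<in> A i" "d \<in> A i" "d \<noteq> 0"
      using zw unfolding Q_def by blast
    then have "c \<noteq> 0" using False by auto
    have "z / w = (a * d) / (b * c)" using ab by simp
    then show ?thesis using QI[of "a * d" "b * c"] ab \<open>c \<noteq> 0\<close> Ai.mult by simp
  qed
  have AQ: "z \<in> Q" if "z \<in> A k" for z
    using that unfolding A_def
  proof induction
    case (scalar c)
    have "\<iota> c \<in> A i" unfolding A_def by (rule alg_gen.scalar)
    then show ?case using QI[OF _ Ai.one] by simp
  next
    case (gen z)
    then obtain j where j: "j \<le> N" "z = x j / x k" by blast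
    \<comment> \<open>The change of coordinates from chart \<open>k\<close> to chart
      \<open>i\<close>.\<close>
    have "z = (x j / x i) / (x k / x i)" using i(2) by (simp add: j)
    moreover have "x j / x i \<in> A i" "x k / x i \<in> A i"
      unfolding A_def using j k by (auto intro!: alg_gen.gen)
    ultimately show ?case using QI[of "x j / x i" "x k / x i"] i(2) k(2) by simp
  next
    case (add z w)
    then obtain a b c d where ab: "z = a / b" "a \<in> A i" "b \<in> A i" "b \<noteq> 0"
      "w = c / d" "c \<in> A i" "d \<in> A i" "d \<noteq> 0"
      unfolding Q_def by blast
    then have "z + w = (a * d + c * b) / (b * d)" by (simp add: field_simps)
    then show ?case using QI[of "a * d + c * b" "b * d"] ab Ai.mult Ai.add by simp
  next
    case (mult z w)
    then obtain a b c d where ab: "z = a / b" "a \<in> A i" "b \<in> A i" "b \<noteq> 0"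
      "w = c / d" "c \<in> A i" "d \<in> A i" "d \<noteq> 0"
      unfolding Q_def by blast
    then have "z * w = (a * c) / (b * d)" by simp
    then show ?case using QI[of "a * c" "b * d"] ab Ai.mult by simp
  qed
  have "\<exists>a\<in>A i. \<exists>b\<in>A i. b \<noteq> 0 \<and> z = a / b" for z
  proof -
    obtain r where "UNIV = localization (A k) r" using k unfolding spec_def by blast
    then obtain a b where "z = a / b" "a \<in> A k" "b \<in> A k" unfolding localization_def by blast
    then have "z \<in> Q" using AQ Qdiv by blast
    then show ?thesis unfolding Q_def by blast
  qed
  moreover have "finite {x j / x i | j. j \<le> N}" by simp
  ultimately show ?thesis using that p unfolding A_def by blast
qed

section \<open>The divisor of the canonical one-form\<close>

theorem theorem3p6:
  fixes \<iota> :: "'k::alg_closed_field \<Rightarrow> 'a::field"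
    and S :: "'a set set" and n :: nat and C :: "nat \<Rightarrow> 'a set"
    and I :: "'i set" and R :: "'i \<Rightarrow> 'a set" and f g :: "'i \<Rightarrow> 'a" and c :: "'i \<Rightarrow> 'i \<Rightarrow> 'a"
    and \<eta> :: "('a \<Rightarrow>\<^sub>0 'a) set" and A B :: "'a set \<Rightarrow> int"
  assumes "CHAR('k) = 2" and "field_embedding \<iota>"
    and "coble_surface \<iota> S n C"
    and "canonical_covering_data \<iota> S n C I R f c g"
    and "canonical_one_form \<iota> I f g \<eta>"
    and "conductrix \<iota> S I R f g A"
  shows "form_divisor1 S \<eta> = (\<lambda>P. - boundary_divisor n C P + 2 * A P) \<and>
    (bi_conductrix S n C \<eta> B \<longrightarrow> B = (\<lambda>P. 2 * A P))"
proof -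
  note emb = \<open>field_embedding \<iota>\<close>
  note two = field_embedding_two[OF assms(1,2)]
  have S: "projective_variety \<iota> S" "nonsingular S" "rational_function_field2 \<iota>"
    using assms(3) unfolding coble_surface_def rational_surface_def by blast+
  have sq: "\<forall>c. \<exists>e. \<iota> c = e\<^sup>2" using field_embedding_square[OF emb] by blast
  obtain r s where rs: "two_independent r (s :: 'a)" "two_spanning r s"
    using rational_function_field2_two_basis[OF assms(1,2) S(3)] .
  have fg: "f i \<noteq> 0" "g i \<noteq> 0" "g i \<in> R i" "inverse (g i) \<in> R i"
    "\<And>P. P \<in> spec (R i) \<Longrightarrow> P \<in> prime_divisors S \<Longrightarrow> ord_at P (f i) = boundary_divisor n C P"
    "field_subring (R i)" if "i \<in> I" for i
  proof -
    note cov = assms(4)[unfolded canonical_covering_data_def local_equation_def]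
    show "f i \<noteq> 0" "g i \<noteq> 0" "g i \<in> R i" "inverse (g i) \<in> R i"
      using cov that by blast+
    show "P \<in> spec (R i) \<Longrightarrow> P \<in> prime_divisors S \<Longrightarrow> ord_at P (f i) = boundary_divisor n C P" for P
      using cov that by blast
    have "affine_open \<iota> S (R i)" using cov that by blast
    then show "field_subring (R i)"
      using alg_gen_subring[OF emb] by (auto simp: affine_open_def)
  qed
  obtain \<V> where V: "\<forall>V\<in>\<V>. affine_open \<iota> S V" "S = (\<Union>V\<in>\<V>. spec V)"
    "\<forall>V\<in>\<V>. \<exists>i\<in>I. spec V \<subseteq> spec (R i) \<and>
           (\<exists>w. \<exists>h\<in>V. \<exists>a\<in>V. \<exists>b\<in>V.
              normalization_ring V (f i * g i) = {[:x:] + smult y w | x y. x \<in> V \<and> y \<in> V} \<and>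
              [:- (f i * g i), 0, 1:] dvd w * w - [:h:] \<and>
              [:0, 1:] = [:b:] + smult a w \<and>
              local_equation S (spec V) A a)"
    using assms(6) unfolding conductrix_def by blast
  \<comment> \<open>At a point of codimension one the local ring is a discrete valuation ring, and
    the orders can be compared there.\<close>
  have main: "form_divisor1 S \<eta> P = - boundary_divisor n C P + 2 * A P" if P: "P \<in> prime_divisors S" for P
  proof -
    have PS: "P \<in> S" and dim: "krull_dim_quot P {0} 1" using P by (auto simp: prime_divisors_def)
    obtain X p where X: "finite X" "prime_ideal (alg_gen \<iota> X) p" "P = localization (alg_gen \<iota> X) p"
      and frac: "\<And>x. \<exists>a\<in>alg_gen \<iota> X. \<exists>b\<in>alg_gen \<iota> X. b \<noteq> 0 \<and> x = a / b"
      using projective_variety_local_ring[OF emb S(1) PS] by metis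
    interpret X: field_subring "alg_gen \<iota> X" by (rule alg_gen_subring) fact
    have "alg_gen \<iota> X \<subseteq> P" using X.localization_subset X by blast
    then have "\<exists>a\<in>P. \<exists>b\<in>P. b \<noteq> 0 \<and> x = a / b" for x using frac by blast
    moreover have "field_subring P" using X.localization_subring X by blast
    ultimately obtain t where "dvr P t"
      using regular_dim_one_dvr dim S(2) PS unfolding nonsingular_def by metis
    then interpret dvr P t .
    obtain V where "V \<in> \<V>" "P \<in> spec V" using PS V(2) by blast
    obtain i where i: "i \<in> I" "spec V \<subseteq> spec (R i)"
      and loc: "\<exists>w. \<exists>h\<in>V. \<exists>a\<in>V. \<exists>b\<in>V.
              normalization_ring V (f i * g i) = {[:x:] + smult y w | x y. x \<in> V \<and> y \<in> V} \<and>
              [:- (f i * g i), 0, 1:] dvd w * w - [:h:] \<and>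
              [:0, 1:] = [:b:] + smult a w \<and>
              local_equation S (spec V) A a"
      using bspec[OF V(3) \<open>V \<in> \<V>\<close>] by (elim bexE conjE)
    obtain w h a b where hab: "h \<in> V" "a \<in> V" "b \<in> V"
      and norm: "normalization_ring V (f i * g i) = {[:x:] + smult y w | x y. x \<in> V \<and> y \<in> V}"
      and h: "[:- (f i * g i), 0, 1:] dvd w * w - [:h:]" and z: "[:0, 1:] = [:b:] + smult a w"
      and a: "local_equation S (spec V) A a"
      using loc by (elim exE bexE conjE)
    have Pi: "P \<in> spec (R i)" using i(2) \<open>P \<in> spec V\<close> by blast
    obtain q where q: "prime_ideal V q" "P = localization V q"
      using \<open>P \<in> spec V\<close> unfolding spec_def by blast
    have subV: "field_subring V"
      using V(1) \<open>V \<in> \<V>\<close> alg_gen_subring[OF emb] by (auto simp: affine_open_def)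
    then have hP: "h \<in> P" using field_subring.localization_subset q hab(1) by blast
    \<comment> \<open>Normality of the refined covering enters through this condition on
      \<open>h\<close>.\<close>
    have ns: "\<forall>s\<in>P. \<forall>y\<in>P. h \<noteq> s\<^sup>2 + t\<^sup>2 * y"
      using normalization_not_square_mod[OF two subV q uniformizer norm h z] by blast
    note F = normalization_equation[OF two h z]
    have bound: "\<forall>D. derivation \<iota> D \<and> (\<exists>z. D z \<noteq> 0) \<longrightarrow>
        (\<exists>x\<in>P. D x \<noteq> 0 \<and> (\<forall>y\<in>P. D y / D x \<in> P))"
      using derivation_bound[OF emb two X frac] by blast
    obtain D where D: "derivation \<iota> D" "D h \<in> P - max_ideal P" "D ` P \<subseteq> P"
      using derivation_unit[OF two sq rs bound hP ns] by metis
    have eta: "\<eta> = form_class (form_relations1 \<iota>) (Poly_Mapping.single (f i * g i) (1 / (f i * g i)))"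
      using assms(5) i(1) unfolding canonical_one_form_def by blast
    have "form_divisor1 S \<eta> P = 2 * ord_at P a - ord_at P (f i * g i)"
      using form_ord_dlog[OF two F(3) _ F(1) hP D] fg(1,2)[OF i(1)] P
      by (simp add: form_divisor1_def eta)
    moreover have "ord_at P a = A P"
      using a P \<open>P \<in> spec V\<close> unfolding local_equation_def by blast
    \<comment> \<open>The factor \<open>g i\<close> is a unit at \<open>P\<close>, so only the
      boundary equation \<open>f i\<close> contributes.\<close>
    moreover have "ord_at P (f i * g i) = boundary_divisor n C P"
    proof -
      obtain q' where "prime_ideal (R i) q'" "P = localization (R i) q'"
        using Pi unfolding spec_def by blast
      then have "R i \<subseteq> P" using field_subring.localization_subset fg(6)[OF i(1)] by blast
      then have g: "g i \<in> P - max_ideal P" unfolding unit_iff using fg(2-4)[OF i(1)] by blast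
      obtain u where u: "u \<in> P - max_ideal P" "f i = t powi ord_at P (f i) * u"
        using ord_at_decomposition[OF fg(1)[OF i(1)]] .
      have "f i * g i = t powi ord_at P (f i) * (u * g i)"
        by (subst u(2)) (simp only: mult.assoc)
      then have "ord_at P (f i * g i) = ord_at P (f i)"
        using unit_mult[OF u(1) g] by (intro ord_at_eq)
      then show ?thesis using fg(5)[OF i(1) Pi P] by simp
    qed
    ultimately show ?thesis by simp
  qed
  have "form_divisor1 S \<eta> P = - boundary_divisor n C P + 2 * A P" for P
  proof (cases "P \<in> prime_divisors S")
    case False
    \<comment> \<open>Elsewhere all terms are zero, since the boundary components and the support of
      \<open>A\<close> are prime divisors.\<close>
    have "C i \<in> prime_divisors S" if "i \<in> {1..n}" for i
      using assms(3) that unfolding coble_surface_def nonsingular_rational_curve_def by blast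
    then have "boundary_divisor n C P = 0"
      unfolding boundary_divisor_def using False by (intro sum.neutral) auto
    moreover have "A P = 0"
      using assms(6) False unfolding conductrix_def divisor_def by blast
    ultimately show ?thesis using False by (simp add: form_divisor1_def)
  qed (rule main)
  then show ?thesis
    by (auto simp: bi_conductrix_def fun_eq_iff)
qed

end
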